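(* Let $\{W(t):t\ge 0\}$ be a standard Wiener process, and let $W_0(t):=W(t)-\int_0^1 W(u)\,du$ for $t\in[0,1]$ be the mean-centered Wiener process. Then the Karhunen–Loève (KL) expansion of $\{W_0(t):t\in[0,1]\}$ is given by $$W_0(t)=W(t)-\int_0^1 W(u)\,du \stackrel{\text{law}}{=} \sum_{k=1}^{\infty}\omega_k\,\frac{\sqrt2\,\cos(k\pi t)}{k\pi}\qquad\text{for } t\in[0,1],$$ where $\{\omega_k:k\ge1\}$ is a sequence of independent $N(0,1)$ random variables. (That is, the KL eigenvalues are $\lambda_k=1/(k\pi)^2$, with orthonormal eigenfunctions $e_k(t)=\sqrt2\cos(k\pi t)$, $k\ge 1$.)
   Context: $\stackrel{\text{law}}{=}$ denotes equality in distribution (of processes). For a centered Gaussian process $\{\zeta(t):t\in[0,1]\}$ with covariance function $K_\zeta(s,t)=E(\zeta(s)\zeta(t))\in L^2([0,1]^2)$, the KL expansion of $\zeta$ is the representation (convergent in expected mean squares) $$\zeta(t)\stackrel{\text{law}}{=}\sum_{k\ge1}\omega_k\sqrt{\lambda_k}\,e_k(t),$$ where $\{\omega_k\}$ are i.i.d. $N(0,1)$, $\{e_k\}$ is an orthonormal sequence in $L^2([0,1])$, and $\lambda_1\ge\lambda_2\ge\cdots\ge0$ are the eigenvalues (repeated according to multiplicity; the eigenvalue $0$ may be omitted) of the Fredholm operator $T_\zeta h(t)=\int_0^1K_\zeta(s,t)h(s)\,ds$ on $L^2([0,1])$, with $T_\zeta e_k=\lambda_ke_k$ for each $k$. *)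

theory Defs
  imports "HOL-Probability.Probability"
begin

definition standard_wiener :: "'a measure \<Rightarrow> (real \<Rightarrow> 'a \<Rightarrow> real) \<Rightarrow> bool" where
  "standard_wiener M W \<longleftrightarrow>
     prob_space M \<and>
     (\<forall>t\<ge>0. W t \<in> borel_measurable M) \<and>
     (AE x in M. W 0 x = 0) \<and>
     (\<forall>s t. 0 \<le> s \<and> s < t \<longrightarrow>
        distributed M lborel (\<lambda>x. W t x - W s x) (normal_density 0 (sqrt (t - s)))) \<and>
     (\<forall>n (t :: nat \<Rightarrow> real). 0 \<le> t 0 \<and> (\<forall>i<n. t i < t (Suc i)) \<longrightarrow>
        prob_space.indep_vars M (\<lambda>_. borel) (\<lambda>i x. W (t (Suc i)) x - W (t i) x) {..<n}) \<and>
     (AE x in M. continuous_on {0..} (\<lambda>t. W t x))"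

definition mean_centered :: "(real \<Rightarrow> 'a \<Rightarrow> real) \<Rightarrow> real \<Rightarrow> 'a \<Rightarrow> real" where
  "mean_centered W t x = W t x - (LINT u:{0..1}|lborel. W u x)"

definition iid_std_normal :: "'a measure \<Rightarrow> (nat \<Rightarrow> 'a \<Rightarrow> real) \<Rightarrow> bool" where
  "iid_std_normal N \<omega> \<longleftrightarrow>
     prob_space N \<and>
     prob_space.indep_vars N (\<lambda>_. borel) \<omega> {1..} \<and>
     (\<forall>k\<ge>1. distributed N lborel (\<omega> k) std_normal_density)"

text \<open>Degenerate (almost surely zero) variables count as Gaussian.\<close>

definition centered_gaussian :: "'a measure \<Rightarrow> ('a \<Rightarrow> real) \<Rightarrow> bool" where
  "centered_gaussian M X \<longleftrightarrow>
     X \<in> borel_measurable M \<and>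
     ((AE x in M. X x = 0) \<or> (\<exists>\<sigma>>0. distributed M lborel X (normal_density 0 \<sigma>)))"

definition centered_gaussian_process ::
    "'a measure \<Rightarrow> real set \<Rightarrow> (real \<Rightarrow> 'a \<Rightarrow> real) \<Rightarrow> bool" where
  "centered_gaussian_process M I \<zeta> \<longleftrightarrow>
     prob_space M \<and>
     (\<forall>J c. finite J \<and> J \<subseteq> I \<longrightarrow> centered_gaussian M (\<lambda>x. \<Sum>t\<in>J. c t * \<zeta> t x))"

text \<open>The law lives on the product \<open>\<sigma>\<close>-algebra, so equality of laws amounts to equality of all
  finite-dimensional distributions.\<close>

definition process_law ::
    "'a measure \<Rightarrow> real set \<Rightarrow> (real \<Rightarrow> 'a \<Rightarrow> real) \<Rightarrow> (real \<Rightarrow> real) measure" where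
  "process_law M I X = distr M (PiM I (\<lambda>_. borel)) (\<lambda>x. \<lambda>t\<in>I. X t x)"

definition square_integrable :: "'a measure \<Rightarrow> ('a \<Rightarrow> real) \<Rightarrow> bool" where
  "square_integrable M f \<longleftrightarrow> f \<in> borel_measurable M \<and> integrable M (\<lambda>x. (f x)\<^sup>2)"

text \<open>\<open>\<zeta>(t)\<close> equals \<open>\<Sum>k\<ge>1. X k t\<close> in law, as processes on \<open>I\<close>, where for each \<open>t\<close> the series
  converges in mean square to \<open>Y t\<close>. The spaces \<open>M\<close> and \<open>N\<close> may be different.\<close>

definition law_eq_series ::
    "'a measure \<Rightarrow> real set \<Rightarrow> (real \<Rightarrow> 'a \<Rightarrow> real) \<Rightarrow>
     'b measure \<Rightarrow> (nat \<Rightarrow> real \<Rightarrow> 'b \<Rightarrow> real) \<Rightarrow> bool" where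
  "law_eq_series M I \<zeta> N X \<longleftrightarrow>
     (\<forall>k\<ge>1. \<forall>t\<in>I. square_integrable N (X k t)) \<and>
     (\<exists>Y. (\<forall>t\<in>I. square_integrable N (Y t) \<and>
               (\<lambda>n. LINT y|N. ((\<Sum>k=1..n. X k t y) - Y t y)\<^sup>2) \<longlonglongrightarrow> 0) \<and>
          process_law M I \<zeta> = process_law N I Y)"

definition covariance :: "'a measure \<Rightarrow> (real \<Rightarrow> 'a \<Rightarrow> real) \<Rightarrow> real \<Rightarrow> real \<Rightarrow> real" where
  "covariance M \<zeta> s t = (LINT x|M. \<zeta> s x * \<zeta> t x)"

abbreviation unit_lebesgue :: "real measure" where
  "unit_lebesgue \<equiv> lebesgue_on {0..1}"

definition fredholm :: "(real \<Rightarrow> real \<Rightarrow> real) \<Rightarrow> (real \<Rightarrow> real) \<Rightarrow> real \<Rightarrow> real" where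
  "fredholm K h t = (LINT s|unit_lebesgue. K s t * h s)"

text \<open>Membership in the \<open>\<mu>\<close>-eigenspace in \<open>L\<^sup>2([0,1])\<close>, for functions rather than almost-everywhere
  classes; the zero function is included.\<close>

definition in_eigenspace :: "(real \<Rightarrow> real \<Rightarrow> real) \<Rightarrow> real \<Rightarrow> (real \<Rightarrow> real) \<Rightarrow> bool" where
  "in_eigenspace K \<mu> h \<longleftrightarrow>
     square_integrable unit_lebesgue h \<and>
     (AE t in unit_lebesgue. fredholm K h t = \<mu> * h t)"

definition orthonormal_seq :: "(nat \<Rightarrow> real \<Rightarrow> real) \<Rightarrow> bool" where
  "orthonormal_seq e \<longleftrightarrow>
     (\<forall>k\<ge>1. square_integrable unit_lebesgue (e k)) \<and>
     (\<forall>j\<ge>1. \<forall>k\<ge>1. (LINT t|unit_lebesgue. e j t * e k t) = (if j = k then 1 else 0))"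

text \<open>Sequences are indexed from 1. The last conjunct says that the \<open>lam k\<close> exhaust the nonzero
  eigenvalues with multiplicity: together with orthonormality, the \<open>e k\<close> with \<open>lam k = \<mu>\<close> form a
  basis of the \<open>\<mu>\<close>-eigenspace, which is trivial if no such \<open>k\<close> exists. Nothing is required for
  \<open>\<mu> = 0\<close>, as the eigenvalue 0 may be omitted.\<close>

definition eigen_system ::
    "(real \<Rightarrow> real \<Rightarrow> real) \<Rightarrow> (nat \<Rightarrow> real) \<Rightarrow> (nat \<Rightarrow> real \<Rightarrow> real) \<Rightarrow> bool" where
  "eigen_system K lam e \<longleftrightarrow>
     orthonormal_seq e \<and>
     (\<forall>k\<ge>1. 0 \<le> lam k) \<and>
     (\<forall>j\<ge>1. \<forall>k\<ge>j. lam k \<le> lam j) \<and>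
     (\<forall>k\<ge>1. in_eigenspace K (lam k) (e k)) \<and>
     (\<forall>\<mu>. \<mu> \<noteq> 0 \<longrightarrow>
        finite {k. 1 \<le> k \<and> lam k = \<mu>} \<and>
        (\<forall>h. in_eigenspace K \<mu> h \<longrightarrow>
           (\<exists>c. AE t in unit_lebesgue. h t = (\<Sum>k | 1 \<le> k \<and> lam k = \<mu>. c k * e k t))))"

definition KL_expansion ::
    "'a measure \<Rightarrow> (real \<Rightarrow> 'a \<Rightarrow> real) \<Rightarrow> (nat \<Rightarrow> real) \<Rightarrow> (nat \<Rightarrow> real \<Rightarrow> real) \<Rightarrow>
     'b measure \<Rightarrow> (nat \<Rightarrow> 'b \<Rightarrow> real) \<Rightarrow> bool" where
  "KL_expansion M \<zeta> lam e N \<omega> \<longleftrightarrow>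
     centered_gaussian_process M {0..1} \<zeta> \<and>
     square_integrable (lebesgue_on ({0..1} \<times> {0..1})) (\<lambda>(s, t). covariance M \<zeta> s t) \<and>
     eigen_system (covariance M \<zeta>) lam e \<and>
     iid_std_normal N \<omega> \<and>
     law_eq_series M {0..1} \<zeta> N (\<lambda>k t y. \<omega> k y * sqrt (lam k) * e k t)"

text \<open>If the paths of \<open>W\<close> are only almost surely continuous, the path integral in
  \<open>mean_centered W\<close> need not be measurable with respect to \<open>M\<close> itself, only with respect to the
  \<open>completion\<close> of \<open>M\<close>, which therefore is the space on which that process is to be considered.
  Variables that are already measurable for \<open>M\<close> have the same law on both spaces.\<close>

end

theory Submission
  imports Defs
begin

text \<open>
  Everything rests on one kernel, \<open>K(s,t) = 1/3 - max s t + (s\<^sup>2 + t\<^sup>2) / 2\<close>. A centered Gaussian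
  process is determined in law by its covariance, so it is enough to see that \<open>K\<close> is the
  covariance both of the mean-centered Wiener process and of the random cosine series.

  On the Wiener side, a linear combination of values of \<open>W\<close> is a linear combination of independent
  increments, hence Gaussian with covariance \<open>min s t\<close>. The path integral \<open>\<integral>W\<close> is almost surely a
  limit of Riemann sums, and an almost sure limit of centered Gaussians with convergent variances
  is Gaussian with the limiting variance; passing to the limit turns \<open>min\<close> into \<open>K\<close>
  (\<open>mean_centered_gaussian\<close>).

  On the series side, the Fourier series \<open>\<Sum> cos(k x) / k\<^sup>2 = x\<^sup>2/4 - \<pi> x/2 + \<pi>\<^sup>2/6\<close> on
  \<open>[0, 2\<pi>]\<close> (\<open>cos_series_Bernoulli\<close>), taken at \<open>x = \<pi> \<bar>s - t\<bar>\<close> and at \<open>x = \<pi> (s + t)\<close>, gives the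
  absolutely convergent expansion \<open>K(s,t) = \<Sum> \<lambda>\<^sub>k e\<^sub>k(s) e\<^sub>k(t)\<close> with \<open>\<lambda>\<^sub>k = 1/(k\<pi>)\<^sup>2\<close> and
  \<open>e\<^sub>k(t) = \<surd>2 cos(k\<pi>t)\<close> (\<open>centered_wiener_kernel_Mercer\<close>). This expansion does double duty.
  It is the covariance of the series \<open>\<Sum> \<omega>\<^sub>k \<surd>\<lambda>\<^sub>k e\<^sub>k\<close>, which converges in mean square by
  completeness of \<open>L\<^sup>2\<close> (\<open>gaussian_law_eq_series\<close>). It also settles the eigenvalue problem
  without any differential equation: for \<open>h\<close> in \<open>L\<^sup>2\<close> one may integrate the series term by
  term, so \<open>T h = \<Sum> \<lambda>\<^sub>k \<langle>h, e\<^sub>k\<rangle> e\<^sub>k\<close>, from which all eigenfunctions with nonzero eigenvalue can be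
  read off (\<open>eigen_system_Mercer\<close>).

  The statement that finite-dimensional laws of Gaussian processes are determined by the covariance
  is a Cramer-Wold argument: the characteristic functions of all linear combinations determine the
  joint law. It is reduced to the uniqueness theorem on the real line by treating one coordinate
  at a time (\<open>indicators_from_cosines\<close>).
\<close>

section \<open>Joint laws are determined by linear combinations\<close>

text \<open>The law of \<open>X\<close> under the probability measure with density proportional to \<open>w\<close>. Its characteristic
  function is recorded through cosines with a phase shift, because \<open>sin x = cos (x - \<pi>/2)\<close>: this
  keeps all comparisons of expectations real-valued.\<close>

lemma tilted_law:
  fixes X :: "'a \<Rightarrow> real" and w :: "'a \<Rightarrow> real"
  assumes M: "prob_space M"
    and X[measurable]: "X \<in> borel_measurable M" and w[measurable]: "w \<in> borel_measurable M"
    and w0: "\<And>x. 0 \<le> w x" and wB: "\<And>x. w x \<le> B"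
    and m: "m = (\<integral>x. w x \<partial>M)" "0 < m"
  defines "P \<equiv> distr (density M (\<lambda>x. ennreal (w x / m))) borel X"
  shows "real_distribution P"
    and "char P u = (complex_of_real (\<integral>x. w x * cos (u * X x + 0) \<partial>M)
           + \<i> * complex_of_real (\<integral>x. w x * cos (u * X x + (- pi / 2)) \<partial>M)) / m"
    and "A \<in> sets borel \<Longrightarrow> measure P A = (\<integral>x. w x * indicator A (X x) \<partial>M) / m"
proof -
  interpret prob_space M by fact
  have bnd: "integrable M (\<lambda>x. w x * f x)" if [measurable]: "f \<in> borel_measurable M"
    and f: "\<And>x. \<bar>f x\<bar> \<le> 1" for f
  proof (rule integrable_const_bound[where B=B])
    have "norm (w x * f x) \<le> B" for x
    proof -
      have "\<bar>w x\<bar> * \<bar>f x\<bar> \<le> B * 1" using w0[of x] wB[of x] f[of x] by (intro mult_mono) auto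
      then show ?thesis by (simp add: abs_mult)
    qed
    then show "AE x in M. norm (w x * f x) \<le> B" by simp
  qed measurable
  have wi: "integrable M w" using bnd[of "\<lambda>_. 1"] by simp
  let ?D = "density M (\<lambda>x. ennreal (w x / m))"
  have "emeasure ?D (space ?D) = (\<integral>\<^sup>+x. ennreal (w x / m) \<partial>M)"
    by (subst emeasure_density) (auto intro!: nn_integral_cong simp: indicator_def)
  also have "\<dots> = ennreal (\<integral>x. w x / m \<partial>M)"
    using wi w0 m by (intro nn_integral_eq_integral) auto
  also have "\<dots> = 1" using m by simp
  finally have D: "prob_space ?D" by (rule prob_spaceI)
  then interpret D: prob_space ?D .
  show "real_distribution P" unfolding P_def
    by (intro D.real_distribution_distr) simp
  have euler: "iexp r = complex_of_real (cos (r + 0)) + \<i> * complex_of_real (cos (r + (- pi / 2)))" for r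
    by (simp add: cis_conv_exp[symmetric] complex_eq_iff cos_diff)
  have "char P u = (\<integral>x. iexp (u * X x) \<partial>?D)"
    unfolding char_def P_def by (subst integral_distr) auto
  also have "\<dots> = (\<integral>x. (w x / m) *\<^sub>R iexp (u * X x) \<partial>M)"
    using w0 m by (subst integral_density) auto
  also have "\<dots> = (\<integral>x. (complex_of_real (w x * cos (u * X x + 0)) + \<i> * complex_of_real (w x * cos (u * X x + (- pi / 2)))) / m \<partial>M)"
    unfolding euler by (simp add: scaleR_conv_of_real algebra_simps add_divide_distrib)
  also have "\<dots> = (complex_of_real (\<integral>x. w x * cos (u * X x + 0) \<partial>M)
           + \<i> * complex_of_real (\<integral>x. w x * cos (u * X x + (- pi / 2)) \<partial>M)) / m"
  proof -
    have i1: "integrable M (\<lambda>x. complex_of_real (w x * cos (u * X x + b)))" for b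
      using bnd[of "\<lambda>x. cos (u * X x + b)"] by (intro integrable_of_real) auto
    show ?thesis
      using i1[of 0] i1[of "-pi/2"]
      by (subst integral_divide_zero, subst Bochner_Integration.integral_add)
         (auto simp only: integral_mult_right_zero integral_complex_of_real integrable_mult_right)
  qed
  finally show "char P u = (complex_of_real (\<integral>x. w x * cos (u * X x + 0) \<partial>M)
           + \<i> * complex_of_real (\<integral>x. w x * cos (u * X x + (- pi / 2)) \<partial>M)) / m" .
  assume A[measurable]: "A \<in> sets borel"
  have "measure P A = (\<integral>x. indicator A x \<partial>P)" by (simp add: P_def)
  also have "\<dots> = (\<integral>x. indicator A (X x) \<partial>?D)"
    unfolding P_def by (subst integral_distr) auto
  also have "\<dots> = (\<integral>x. (w x / m) *\<^sub>R indicator A (X x) \<partial>M)"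
    using w0 m by (subst integral_density) auto
  also have "\<dots> = (\<integral>x. w x * indicator A (X x) \<partial>M) / m" by simp
  finally show "measure P A = (\<integral>x. w x * indicator A (X x) \<partial>M) / m" .
qed

text \<open>Levy's uniqueness theorem for finite measures \<open>w dM\<close> in place of probability measures: either the
  common total mass vanishes and both sides are \<open>0\<close>, or one normalizes.\<close>

lemma weighted_Levy_uniqueness:
  fixes X :: "'a \<Rightarrow> real" and Y :: "'b \<Rightarrow> real"
  assumes M: "prob_space M" and N: "prob_space N"
    and X[measurable]: "X \<in> borel_measurable M" and Y[measurable]: "Y \<in> borel_measurable N"
    and v[measurable]: "v \<in> borel_measurable M" and w[measurable]: "w \<in> borel_measurable N"
    and v0: "\<And>x. 0 \<le> v x" and vB: "\<And>x. v x \<le> B"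
    and w0: "\<And>x. 0 \<le> w x" and wB: "\<And>x. w x \<le> B"
    and eq: "\<And>u b. (\<integral>x. v x * cos (u * X x + b) \<partial>M) = (\<integral>y. w y * cos (u * Y y + b) \<partial>N)"
    and A[measurable]: "A \<in> sets borel"
  shows "(\<integral>x. v x * indicator A (X x) \<partial>M) = (\<integral>y. w y * indicator A (Y y) \<partial>N)"
proof -
  interpret M: prob_space M by fact
  interpret N: prob_space N by fact
  define m where "m = (\<integral>x. v x \<partial>M)"
  have m': "m = (\<integral>x. w x \<partial>N)" using eq[of 0 0] by (simp add: m_def)
  have "integrable M v" "integrable N w"
    using v0 vB w0 wB by (auto intro!: M.integrable_const_bound[where B=B] N.integrable_const_bound[where B=B])
  note int = this
  have "0 \<le> m" unfolding m_def using v0 by simp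
  then consider "m = 0" | "0 < m" by linarith
  then show ?thesis
  proof cases
    case 1
    then have "AE x in M. v x = 0" "AE x in N. w x = 0"
      using integral_nonneg_eq_0_iff_AE[OF int(1)] integral_nonneg_eq_0_iff_AE[OF int(2)] v0 w0 m_def m' by auto
    then have "(\<integral>x. v x * indicator A (X x) \<partial>M) = (\<integral>x. 0 \<partial>M)" "(\<integral>x. w x * indicator A (Y x) \<partial>N) = (\<integral>x. 0 \<partial>N)"
      by (auto intro!: integral_eq_zero_AE)
    then show ?thesis by simp
  next
    case 2
    note P = tilted_law[OF M X v v0 vB m_def 2] and Q = tilted_law[OF N Y w w0 wB m' 2]
    have "distr (density M (\<lambda>x. ennreal (v x / m))) borel X = distr (density N (\<lambda>x. ennreal (w x / m))) borel Y"
      by (rule Levy_uniqueness[OF P(1) Q(1)]) (simp only: fun_eq_iff P(2) Q(2) eq simp_thms)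
    with P(3)[OF A] Q(3)[OF A] 2 show ?thesis by simp
  qed
qed

lemma sum_insert_coeff:
  fixes z :: "'t \<Rightarrow> real"
  assumes "finite L"
  shows "(\<Sum>t\<in>insert k L. ((if t \<in> L then c t else 0) + (if t = k then u else 0)) * z t)
       = (\<Sum>t\<in>L. c t * z t) + u * z k"
proof -
  have "(\<Sum>t\<in>insert k L. (if t \<in> L then c t else 0) * z t) = (\<Sum>t\<in>L. c t * z t)"
    using assms by (intro sum.mono_neutral_cong_right) auto
  moreover have "(\<Sum>t\<in>insert k L. (if t = k then u else 0) * z t) = (\<Sum>t\<in>insert k L. if k = t then u * z t else 0)"
    by (intro sum.cong) auto
  ultimately show ?thesis using assms by (simp add: distrib_right sum.distrib)
qed

text \<open>The inductive form of Cramer-Wold. Coordinates in \<open>K\<close> have already been tested with indicators,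
  those in \<open>L\<close> still appear only through \<open>cos (\<Sum> c X + a)\<close>. One more coordinate \<open>X\<^sub>k\<close> moves from the
  cosine to the indicators by one-dimensional uniqueness under a weight. The natural weight
  \<open>g cos V\<close> is not positive, so \<open>g (1 + cos V)\<close> and \<open>g\<close> are used and their results subtracted.\<close>

lemma indicators_from_cosines:
  fixes X :: "'t \<Rightarrow> 'a \<Rightarrow> real" and Y :: "'t \<Rightarrow> 'b \<Rightarrow> real"
  assumes M: "prob_space M" and N: "prob_space N"
    and X[measurable]: "\<And>t. t \<in> I \<Longrightarrow> X t \<in> borel_measurable M"
    and Y[measurable]: "\<And>t. t \<in> I \<Longrightarrow> Y t \<in> borel_measurable N"
    and eq: "\<And>L c a. finite L \<Longrightarrow> L \<subseteq> I \<Longrightarrow>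
      (\<integral>x. cos ((\<Sum>t\<in>L. c t * X t x) + a) \<partial>M) = (\<integral>y. cos ((\<Sum>t\<in>L. c t * Y t y) + a) \<partial>N)"
    and K: "finite K" "K \<subseteq> I" "\<And>t. t \<in> K \<Longrightarrow> A t \<in> sets borel"
    and L: "finite L" "L \<subseteq> I"
  shows "(\<integral>x. (\<Prod>t\<in>K. indicator (A t) (X t x)) * cos ((\<Sum>t\<in>L. c t * X t x) + a) \<partial>M)
       = (\<integral>y. (\<Prod>t\<in>K. indicator (A t) (Y t y)) * cos ((\<Sum>t\<in>L. c t * Y t y) + a) \<partial>N)"
  using K L
proof (induction K arbitrary: L c a)
  case empty
  then show ?case using eq by simp
next
  case (insert k K)
  interpret M: prob_space M by fact
  interpret N: prob_space N by fact
  have kI: "k \<in> I" and KI: "K \<subseteq> I" and Ak: "A k \<in> sets borel"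
    and AK: "\<And>t. t \<in> K \<Longrightarrow> A t \<in> sets borel" using insert.prems by auto
  note IH = insert.IH[OF KI AK]
  define g where "g x = (\<Prod>t\<in>K. indicator (A t) (X t x) :: real)" for x
  define h where "h y = (\<Prod>t\<in>K. indicator (A t) (Y t y) :: real)" for y
  define V where "V x = (\<Sum>t\<in>L. c t * X t x) + a" for x
  define U where "U y = (\<Sum>t\<in>L. c t * Y t y) + a" for y
  have Xm: "X t \<in> borel_measurable M" if "t \<in> L \<or> t \<in> K \<or> t = k" for t
    using that insert.prems KI kI by (auto intro: X)
  have Ym: "Y t \<in> borel_measurable N" if "t \<in> L \<or> t \<in> K \<or> t = k" for t
    using that insert.prems KI kI by (auto intro: Y)
  have Xk[measurable]: "X k \<in> borel_measurable M" and Yk[measurable]: "Y k \<in> borel_measurable N"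
    using Xm Ym by auto
  have [measurable]: "V \<in> borel_measurable M" "U \<in> borel_measurable N"
    unfolding V_def U_def using Xm Ym
    by (auto intro!: borel_measurable_add borel_measurable_sum borel_measurable_times)
  have [measurable]: "(\<lambda>x. indicator (A t) (X t x) :: real) \<in> borel_measurable M"
     "(\<lambda>x. indicator (A t) (Y t x) :: real) \<in> borel_measurable N" if "t \<in> K" for t
    using Xm[of t] Ym[of t] AK[OF that] that by (auto intro!: borel_measurable_indicator')
  have [measurable]: "g \<in> borel_measurable M" "h \<in> borel_measurable N"
    unfolding g_def h_def by (auto intro!: borel_measurable_prod)
  have g01: "0 \<le> g x" "g x \<le> 1" for x unfolding g_def by (auto intro!: prod_nonneg prod_le_1)
  have h01: "0 \<le> h x" "h x \<le> 1" for x unfolding h_def by (auto intro!: prod_nonneg prod_le_1)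
  have gi: "integrable M (\<lambda>x. g x * f x)" if [measurable]: "f \<in> borel_measurable M" and "\<And>x. \<bar>f x\<bar> \<le> 1" for f
    using that(2) g01 by (intro M.integrable_const_bound[where B=1]) (auto simp: abs_mult intro!: mult_le_one)
  have hi: "integrable N (\<lambda>x. h x * f x)" if [measurable]: "f \<in> borel_measurable N" and "\<And>x. \<bar>f x\<bar> \<le> 1" for f
    using that(2) h01 by (intro N.integrable_const_bound[where B=1]) (auto simp: abs_mult intro!: mult_le_one)
  have e1: "(\<integral>x. g x * cos (u * X k x + b) \<partial>M) = (\<integral>y. h y * cos (u * Y k y + b) \<partial>N)" for u b
    using IH[of "{k}" "\<lambda>_. u" b] kI by (simp add: g_def h_def)
  have e2: "(\<integral>x. g x * cos (V x + (u * X k x + b)) \<partial>M) = (\<integral>y. h y * cos (U y + (u * Y k y + b)) \<partial>N)" for u b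
    using IH[of "insert k L" "\<lambda>t. (if t \<in> L then c t else 0) + (if t = k then u else 0)" "a + b"]
      insert.prems kI
    unfolding sum_insert_coeff[OF insert.prems(3)]
    by (simp add: g_def h_def V_def U_def algebra_simps)
  \<comment> \<open>Product-to-sum turns the weight \<open>g (1 + cos V)\<close> into expressions covered by the induction hypothesis.\<close>
  have e3: "(\<integral>x. g x * (1 + cos (V x)) * cos (u * X k x + b) \<partial>M) = (\<integral>y. h y * (1 + cos (U y)) * cos (u * Y k y + b) \<partial>N)" for u b
  proof -
    have split: "q * (1 + cos s) * cos r = q * cos r + (q * cos (s + r) + q * cos (s + (- r))) / 2" for q s r :: real
      by (simp add: cos_add cos_diff algebra_simps)
    have n: "- (u * z + b) = (-u) * z + (-b)" for z by simp
    show ?thesis unfolding split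
      by (subst Bochner_Integration.integral_add, (intro gi Bochner_Integration.integrable_divide Bochner_Integration.integrable_add; simp)+,
          subst integral_divide_zero, subst Bochner_Integration.integral_add, (intro gi; simp)+,
          subst Bochner_Integration.integral_add, (intro hi Bochner_Integration.integrable_divide Bochner_Integration.integrable_add; simp)+,
          subst integral_divide_zero, subst Bochner_Integration.integral_add, (intro hi; simp)+)
        (simp only: n e1 e2)
  qed
  have c1: "0 \<le> 1 + cos r" for r :: real using cos_ge_minus_one[of r] by linarith
  have f1: "(\<integral>x. g x * indicator (A k) (X k x) \<partial>M) = (\<integral>y. h y * indicator (A k) (Y k y) \<partial>N)"
    by (rule weighted_Levy_uniqueness[OF M N Xk Yk _ _ _ _ _ _ e1 Ak, where B=1]) (auto simp: g01 h01)
  have two: "q * (1 + cos r) \<le> 2" if "0 \<le> q" "q \<le> 1" for q r :: real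
    using mult_mono[of q 1 "1 + cos r" 2] that c1[of r] by auto
  have f2: "(\<integral>x. g x * (1 + cos (V x)) * indicator (A k) (X k x) \<partial>M) = (\<integral>y. h y * (1 + cos (U y)) * indicator (A k) (Y k y) \<partial>N)"
    by (rule weighted_Levy_uniqueness[OF M N Xk Yk _ _ _ _ _ _ e3 Ak, where B=2]) (auto simp: g01 h01 c1 two)
  have [measurable]: "(\<lambda>x. indicator (A k) (X k x) :: real) \<in> borel_measurable M"
     "(\<lambda>x. indicator (A k) (Y k x) :: real) \<in> borel_measurable N"
    using Ak by (auto intro!: borel_measurable_indicator')
  have split: "q * (1 + s) * i = q * i + q * (s * i)" for q s i :: real by (simp add: algebra_simps)
  have b1: "\<bar>cos s * indicator B z\<bar> \<le> 1" for s :: real and B :: "real set" and z by (simp add: indicator_def)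
  have b2: "\<bar>indicator B z :: real\<bar> \<le> 1" for B :: "real set" and z by (simp add: indicator_def)
  have "(\<integral>x. g x * (cos (V x) * indicator (A k) (X k x)) \<partial>M) = (\<integral>y. h y * (cos (U y) * indicator (A k) (Y k y)) \<partial>N)"
  proof -
    have "(\<integral>x. g x * indicator (A k) (X k x) \<partial>M) + (\<integral>x. g x * (cos (V x) * indicator (A k) (X k x)) \<partial>M) =
       (\<integral>x. g x * (1 + cos (V x)) * indicator (A k) (X k x) \<partial>M)"
      unfolding split by (rule Bochner_Integration.integral_add[symmetric]; intro gi b1 b2; measurable)
    also have "\<dots> = (\<integral>y. h y * (1 + cos (U y)) * indicator (A k) (Y k y) \<partial>N)" by (rule f2)
    also have "\<dots> = (\<integral>x. h x * indicator (A k) (Y k x) \<partial>N) + (\<integral>x. h x * (cos (U x) * indicator (A k) (Y k x)) \<partial>N)"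
      unfolding split by (rule Bochner_Integration.integral_add; intro hi b1 b2; measurable)
    finally show ?thesis using f1 by simp
  qed
  then show ?case using insert.hyps
    by (simp add: g_def h_def V_def U_def mult_ac)
qed

text \<open>Expresses the probability of a cylinder set in the shape produced by \<open>indicators_from_cosines\<close>.\<close>

lemma process_law_cylinder:
  assumes P: "prob_space P" and Z: "\<And>t. t \<in> I \<Longrightarrow> Z t \<in> borel_measurable P"
    and J: "finite J" "J \<subseteq> I" and A: "\<And>i. i \<in> J \<Longrightarrow> A i \<in> sets borel"
  shows "emeasure (process_law P I Z) (prod_emb I (\<lambda>_. borel) J (Pi\<^sub>E J A))
      = ennreal (\<integral>x. (\<Prod>t\<in>J. indicator (A t) (Z t x)) \<partial>P)"
proof -
  interpret P: prob_space P by fact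
  let ?E = "prod_emb I (\<lambda>_. borel) J (Pi\<^sub>E J A)"
  have E: "?E \<in> sets (PiM I (\<lambda>_. borel))" using J A by (intro sets_PiM_I) auto
  have mZ: "(\<lambda>x. \<lambda>t\<in>I. Z t x) \<in> measurable P (PiM I (\<lambda>_. borel))"
    by (intro measurable_restrict Z)
  let ?S = "(\<lambda>x. \<lambda>t\<in>I. Z t x) -` ?E \<inter> space P"
  have S: "?S \<in> sets P" using measurable_sets[OF mZ E] .
  have "emeasure (process_law P I Z) ?E = emeasure P ?S"
    unfolding process_law_def by (rule emeasure_distr[OF mZ E])
  also have "\<dots> = ennreal (\<integral>x. indicator ?S x \<partial>P)" using S by (simp add: P.emeasure_eq_measure)
  also have "(\<integral>x. (indicator ?S x :: real) \<partial>P) = (\<integral>x. (\<Prod>t\<in>J. indicator (A t) (Z t x)) \<partial>P)"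
  proof (intro Bochner_Integration.integral_cong refl)
    fix x assume x: "x \<in> space P"
    have "x \<in> ?S \<longleftrightarrow> (\<forall>t\<in>J. Z t x \<in> A t)"
      using x J(2) by (auto simp: prod_emb_def PiE_def Pi_def extensional_def restrict_def subset_iff)
    moreover have "(\<Prod>t\<in>J. indicator (A t) (Z t x) :: real) = (if \<forall>t\<in>J. Z t x \<in> A t then 1 else 0)"
      using J(1) by (auto simp: indicator_def prod_zero_iff)
    ultimately show "indicator ?S x = (\<Prod>t\<in>J. indicator (A t) (Z t x) :: real)"
      by (simp add: indicator_def)
  qed
  finally show ?thesis .
qed

lemma process_law_eqI:
  fixes X :: "real \<Rightarrow> 'a \<Rightarrow> real" and Y :: "real \<Rightarrow> 'b \<Rightarrow> real"
  assumes M: "prob_space M" and N: "prob_space N"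
    and X: "\<And>t. t \<in> I \<Longrightarrow> X t \<in> borel_measurable M"
    and Y: "\<And>t. t \<in> I \<Longrightarrow> Y t \<in> borel_measurable N"
    and eq: "\<And>L c a. finite L \<Longrightarrow> L \<subseteq> I \<Longrightarrow>
      (\<integral>x. cos ((\<Sum>t\<in>L. c t * X t x) + a) \<partial>M) = (\<integral>y. cos ((\<Sum>t\<in>L. c t * Y t y) + a) \<partial>N)"
  shows "process_law M I X = process_law N I Y"
proof (rule measure_eqI_PiM_infinite)
  show "finite_measure (process_law M I X)"
    unfolding process_law_def
    by (intro prob_space.finite_measure prob_space.prob_space_distr[OF M] measurable_restrict X)
  fix A :: "real \<Rightarrow> real set" and J assume J: "finite J" "J \<subseteq> I" and A: "\<And>i. i \<in> J \<Longrightarrow> A i \<in> sets borel"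
  show "emeasure (process_law M I X) (prod_emb I (\<lambda>_. borel) J (Pi\<^sub>E J A))
      = emeasure (process_law N I Y) (prod_emb I (\<lambda>_. borel) J (Pi\<^sub>E J A))"
    using process_law_cylinder[where A=A, OF M X J A] process_law_cylinder[where A=A, OF N Y J A]
      indicators_from_cosines[where A=A, OF M N X Y eq J A, where L="{}" and a=0] by simp
qed (simp_all add: process_law_def)

section \<open>Completeness of \<open>L\<^sup>2\<close>\<close>

lemma square_integrable_cong:
  assumes "\<And>x. x \<in> space M \<Longrightarrow> f x = g x"
  shows "square_integrable M f \<longleftrightarrow> square_integrable M g"
proof -
  have "f \<in> borel_measurable M \<longleftrightarrow> g \<in> borel_measurable M" by (rule measurable_cong) (rule assms)
  moreover have "integrable M (\<lambda>x. (f x)\<^sup>2) \<longleftrightarrow> integrable M (\<lambda>x. (g x)\<^sup>2)"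
    by (rule Bochner_Integration.integrable_cong) (simp_all add: assms)
  ultimately show ?thesis by (simp add: square_integrable_def)
qed

lemma square_integrable_mult:
  assumes "square_integrable M f" "square_integrable M g"
  shows "integrable M (\<lambda>x. f x * g x)"
proof (rule Bochner_Integration.integrable_bound)
  show "integrable M (\<lambda>x. (f x)\<^sup>2 + (g x)\<^sup>2)" using assms by (simp add: square_integrable_def)
  show "(\<lambda>x. f x * g x) \<in> borel_measurable M" using assms by (auto simp: square_integrable_def)
  have "\<bar>a * b\<bar> \<le> a\<^sup>2 + b\<^sup>2" for a b :: real
  proof -
    have "2 * \<bar>a * b\<bar> \<le> a\<^sup>2 + b\<^sup>2"
      using sum_squares_bound[of "\<bar>a\<bar>" "\<bar>b\<bar>"] by (simp add: abs_mult mult.assoc)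
    then show ?thesis using abs_ge_zero[of "a * b"] by linarith
  qed
  then show "AE x in M. norm (f x * g x) \<le> norm ((f x)\<^sup>2 + (g x)\<^sup>2)" by simp
qed

lemma square_integrable_cmult:
  "square_integrable M f \<Longrightarrow> square_integrable M (\<lambda>x. c * f x)"
  by (auto simp: square_integrable_def power_mult_distrib)

lemma square_integrable_add:
  assumes "square_integrable M f" "square_integrable M g"
  shows "square_integrable M (\<lambda>x. f x + g x)"
  using assms square_integrable_mult[OF assms]
  by (auto simp: square_integrable_def power2_sum mult.assoc)

lemma square_integrable_diff:
  assumes "square_integrable M f" "square_integrable M g"
  shows "square_integrable M (\<lambda>x. f x - g x)"
  using square_integrable_add[OF assms(1) square_integrable_cmult[OF assms(2), of "-1"]] by simp

lemma square_integrable_sum: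
  assumes "\<And>i. i \<in> A \<Longrightarrow> square_integrable M (f i)"
  shows "square_integrable M (\<lambda>x. \<Sum>i\<in>A. f i x)"
  using assms by (induction A rule: infinite_finite_induct)
    (auto intro!: square_integrable_add simp: square_integrable_def[of _ "\<lambda>_. 0"])

text \<open>With steps of squared norm \<open>4\<^sup>-\<^sup>j\<close> the increments have \<open>L\<^sup>1\<close> norm of order \<open>2\<^sup>-\<^sup>j\<close>, so the
  telescoping series converges absolutely almost everywhere.\<close>

lemma (in finite_measure) Cauchy_subsequence_AE_convergent:
  fixes X :: "nat \<Rightarrow> 'a \<Rightarrow> real"
  assumes X: "\<And>n. square_integrable M (X n)"
    and step: "\<And>j. (\<integral>x. (X (Suc j) x - X j x)\<^sup>2 \<partial>M) \<le> (1/4) ^ j"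
  shows "AE x in M. convergent (\<lambda>n. X n x)"
proof -
  have [measurable]: "X n \<in> borel_measurable M" for n using X[of n] by (simp add: square_integrable_def)
  define D where "D j x = X (Suc j) x - X j x" for j x
  have [measurable]: "D j \<in> borel_measurable M" for j unfolding D_def by measurable
  have sqD: "integrable M (\<lambda>x. (D j x)\<^sup>2)" for j
    using square_integrable_diff[OF X X, of "Suc j" j] by (simp add: square_integrable_def D_def)
  define C where "C = measure M (space M) + 1"
  have L1: "(\<integral>\<^sup>+x. ennreal \<bar>D j x\<bar> \<partial>M) \<le> ennreal (C * (1/2) ^ j)" for j
  proof -
    \<comment> \<open>The weights balance: \<open>2\<^sup>j\<close> times the squared norm \<open>4\<^sup>-\<^sup>j\<close> is again \<open>2\<^sup>-\<^sup>j\<close>.\<close>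
    have "\<bar>d\<bar> \<le> (1/2) ^ j + 2 ^ j * d\<^sup>2" for d :: real
    proof -
      have "0 \<le> (2 ^ j * \<bar>d\<bar> - 1)\<^sup>2" by simp
      then have "2 * 2 ^ j * \<bar>d\<bar> \<le> 1 + 2 ^ j * 2 ^ j * d\<^sup>2" by (simp add: power2_eq_square algebra_simps)
      moreover have "0 \<le> 2 ^ j * \<bar>d\<bar>" by simp
      ultimately have "2 ^ j * \<bar>d\<bar> \<le> 1 + 2 ^ j * 2 ^ j * d\<^sup>2" by linarith
      then show ?thesis by (simp add: field_simps power_one_over)
    qed
    then have "(\<integral>\<^sup>+x. ennreal \<bar>D j x\<bar> \<partial>M) \<le> (\<integral>\<^sup>+x. ennreal ((1/2) ^ j + 2 ^ j * (D j x)\<^sup>2) \<partial>M)"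
      by (intro nn_integral_mono ennreal_leI)
    also have "\<dots> = ennreal (\<integral>x. (1/2) ^ j + 2 ^ j * (D j x)\<^sup>2 \<partial>M)"
      using sqD by (intro nn_integral_eq_integral) auto
    also have "(\<integral>x. (1/2) ^ j + 2 ^ j * (D j x)\<^sup>2 \<partial>M) = measure M (space M) * (1/2) ^ j + 2 ^ j * (\<integral>x. (D j x)\<^sup>2 \<partial>M)"
      using sqD by simp
    also have "\<dots> \<le> measure M (space M) * (1/2) ^ j + 2 ^ j * (1/4) ^ j"
      using step[of j] by (intro add_left_mono mult_left_mono) (auto simp: D_def)
    also have "2 ^ j * (1/4) ^ j = (1/2 :: real) ^ j" by (simp flip: power_mult_distrib)
    finally show ?thesis by (simp add: C_def algebra_simps ennreal_leI)
  qed
  have "C \<ge> 0" by (simp add: C_def)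
  have "(\<integral>\<^sup>+x. (\<Sum>j. ennreal \<bar>D j x\<bar>) \<partial>M) = (\<Sum>j. \<integral>\<^sup>+x. ennreal \<bar>D j x\<bar> \<partial>M)"
    by (intro nn_integral_suminf) measurable
  also have "\<dots> \<le> (\<Sum>j. ennreal (C * (1/2) ^ j))"
    by (intro suminf_le L1 summableI)
  also have "\<dots> < \<infinity>"
    using \<open>C \<ge> 0\<close> by (subst suminf_ennreal2) (auto intro!: summable_mult summable_geometric)
  finally have "AE x in M. (\<Sum>j. ennreal \<bar>D j x\<bar>) \<noteq> \<infinity>"
    by (intro nn_integral_PInf_AE) auto
  then show ?thesis
  proof eventually_elim
    fix x assume "(\<Sum>j. ennreal \<bar>D j x\<bar>) \<noteq> \<infinity>"
    then have "summable (\<lambda>j. \<bar>D j x\<bar>)" by (intro summable_suminf_not_top) auto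
    then have "summable (\<lambda>j. D j x)" by (rule summable_rabs_cancel)
    then have "convergent (\<lambda>n. \<Sum>j<n. D j x)" by (simp add: summable_iff_convergent)
    then have "convergent (\<lambda>n. X 0 x + (\<Sum>j<n. D j x))" by (intro convergent_add convergent_const)
    moreover have "X 0 x + (\<Sum>j<n. D j x) = X n x" for n
      by (simp add: D_def sum_lessThan_telescope[of "\<lambda>j. X j x"])
    ultimately show "convergent (\<lambda>n. X n x)" by simp
  qed
qed

text \<open>A fast subsequence converges almost everywhere to some \<open>Y\<close>; Fatou's lemma along this subsequence
  bounds the distance from every late \<open>X\<^sub>n\<close> to \<open>Y\<close> by the Cauchy bound, which shows both that \<open>Y\<close> is
  square integrable and that the whole sequence converges to it.\<close>

lemma (in finite_measure) Riesz_Fischer: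
  fixes X :: "nat \<Rightarrow> 'a \<Rightarrow> real"
  assumes X: "\<And>n. square_integrable M (X n)"
    and Cauchy: "\<And>e. e > 0 \<Longrightarrow> \<exists>N. \<forall>m\<ge>N. \<forall>n\<ge>N. (\<integral>x. (X m x - X n x)\<^sup>2 \<partial>M) \<le> e"
  obtains Y where "square_integrable M Y" "(\<lambda>n. \<integral>x. (X n x - Y x)\<^sup>2 \<partial>M) \<longlonglongrightarrow> 0"
proof -
  have [measurable]: "X n \<in> borel_measurable M" for n using X[of n] by (simp add: square_integrable_def)
  have "\<exists>N. \<forall>m\<ge>N. \<forall>n\<ge>N. (\<integral>x. (X m x - X n x)\<^sup>2 \<partial>M) \<le> (1/4) ^ j" for j by (rule Cauchy) simp
  then obtain K where K: "\<And>j m n. m \<ge> K j \<Longrightarrow> n \<ge> K j \<Longrightarrow> (\<integral>x. (X m x - X n x)\<^sup>2 \<partial>M) \<le> (1/4) ^ j"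
    by metis
  \<comment> \<open>Partial sums make the thresholds monotone; the summand \<open>j\<close> makes them tend to infinity.\<close>
  define r where "r j = (\<Sum>i\<le>j. K i) + j" for j
  have rK: "r j \<ge> K j" "r (Suc j) \<ge> K j" for j
    using member_le_sum[of j "{..j}" K] by (auto simp: r_def)
  have r_ge: "r j \<ge> j" for j by (simp add: r_def)
  have AEc: "AE x in M. convergent (\<lambda>j. X (r j) x)"
    by (rule Cauchy_subsequence_AE_convergent) (auto intro: X K rK)
  define Y where "Y x = lim (\<lambda>j. X (r j) x)" for x
  have [measurable]: "Y \<in> borel_measurable M" unfolding Y_def by measurable
  have AEY: "AE x in M. (\<lambda>j. X (r j) x) \<longlonglongrightarrow> Y x"
    using AEc by eventually_elim (simp add: Y_def convergent_LIMSEQ_iff)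
  have Fatou: "(\<integral>\<^sup>+x. ennreal ((X n x - Y x)\<^sup>2) \<partial>M) \<le> ennreal e"
    if N: "\<forall>m\<ge>N. \<forall>n\<ge>N. (\<integral>x. (X m x - X n x)\<^sup>2 \<partial>M) \<le> e" "n \<ge> N" for n N e
  proof -
    have "(\<integral>\<^sup>+x. ennreal ((X n x - Y x)\<^sup>2) \<partial>M) = (\<integral>\<^sup>+x. liminf (\<lambda>j. ennreal ((X n x - X (r j) x)\<^sup>2)) \<partial>M)"
    proof (intro nn_integral_cong_AE)
      show "AE x in M. ennreal ((X n x - Y x)\<^sup>2) = liminf (\<lambda>j. ennreal ((X n x - X (r j) x)\<^sup>2))"
        using AEY
      proof eventually_elim
        fix x assume "(\<lambda>j. X (r j) x) \<longlonglongrightarrow> Y x"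
        then have "(\<lambda>j. ennreal ((X n x - X (r j) x)\<^sup>2)) \<longlonglongrightarrow> ennreal ((X n x - Y x)\<^sup>2)"
          by (intro tendsto_intros)
        then show "ennreal ((X n x - Y x)\<^sup>2) = liminf (\<lambda>j. ennreal ((X n x - X (r j) x)\<^sup>2))"
          by (intro lim_imp_Liminf[symmetric]) auto
      qed
    qed
    also have "\<dots> \<le> liminf (\<lambda>j. \<integral>\<^sup>+x. ennreal ((X n x - X (r j) x)\<^sup>2) \<partial>M)"
      by (intro nn_integral_liminf) measurable
    also have "\<dots> \<le> ennreal e"
    proof (rule Liminf_le)
      show "eventually (\<lambda>j. (\<integral>\<^sup>+x. ennreal ((X n x - X (r j) x)\<^sup>2) \<partial>M) \<le> ennreal e) sequentially"
        using eventually_ge_at_top[of N]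
      proof eventually_elim
        fix j assume "N \<le> j"
        then have "N \<le> r j" using r_ge[of j] by simp
        have "(\<integral>\<^sup>+x. ennreal ((X n x - X (r j) x)\<^sup>2) \<partial>M) = ennreal (\<integral>x. (X n x - X (r j) x)\<^sup>2 \<partial>M)"
          using square_integrable_diff[OF X X, of n "r j"]
          by (intro nn_integral_eq_integral) (auto simp: square_integrable_def)
        also have "\<dots> \<le> ennreal e" using N \<open>N \<le> r j\<close> by (intro ennreal_leI) auto
        finally show "(\<integral>\<^sup>+x. ennreal ((X n x - X (r j) x)\<^sup>2) \<partial>M) \<le> ennreal e" .
      qed
    qed simp
    finally show ?thesis .
  qed
  have sq: "square_integrable M (\<lambda>x. X n x - Y x)" and le: "(\<integral>x. (X n x - Y x)\<^sup>2 \<partial>M) \<le> e"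
    if "e > 0" "\<forall>m\<ge>N. \<forall>n\<ge>N. (\<integral>x. (X m x - X n x)\<^sup>2 \<partial>M) \<le> e" "n \<ge> N" for n N e
  proof -
    note F = Fatou[OF that(2,3)]
    have "integrable M (\<lambda>x. (X n x - Y x)\<^sup>2)"
      using F by (intro integrableI_bounded) (auto simp: less_top[symmetric] top_unique)
    then show "square_integrable M (\<lambda>x. X n x - Y x)" by (simp add: square_integrable_def)
    show "(\<integral>x. (X n x - Y x)\<^sup>2 \<partial>M) \<le> e"
      using F that(1) by (intro integral_real_bounded) auto
  qed
  obtain N1 where N1: "\<forall>m\<ge>N1. \<forall>n\<ge>N1. (\<integral>x. (X m x - X n x)\<^sup>2 \<partial>M) \<le> 1" using Cauchy[of 1] by auto
  have "square_integrable M (\<lambda>x. X N1 x - (X N1 x - Y x))"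
    by (intro square_integrable_diff X sq[OF _ N1]) auto
  then have Y: "square_integrable M Y" by simp
  have "(\<lambda>n. \<integral>x. (X n x - Y x)\<^sup>2 \<partial>M) \<longlonglongrightarrow> 0"
  proof (rule LIMSEQ_I)
    fix e :: real assume "e > 0"
    then obtain N where N: "\<forall>m\<ge>N. \<forall>n\<ge>N. (\<integral>x. (X m x - X n x)\<^sup>2 \<partial>M) \<le> e / 2" using Cauchy[of "e/2"] by auto
    show "\<exists>no. \<forall>n\<ge>no. norm ((\<integral>x. (X n x - Y x)\<^sup>2 \<partial>M) - 0) < e"
      using le[OF _ N] \<open>e > 0\<close> by (intro exI[of _ N]) fastforce
  qed
  with Y show ?thesis by (rule that)
qed

section \<open>Centered Gaussian variables via characteristic functions\<close>

text \<open>On a probability space: \<open>X\<close> is centered Gaussian with variance \<open>v\<close>, degenerate if \<open>v = 0\<close>. Stating this through the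
  characteristic function makes independent sums and limits immediate and avoids a case distinction
  on \<open>v\<close> until the density is needed.\<close>

definition gaussian_char :: "'a measure \<Rightarrow> ('a \<Rightarrow> real) \<Rightarrow> real \<Rightarrow> bool" where
  "gaussian_char M X v \<longleftrightarrow> X \<in> borel_measurable M \<and>
     (\<forall>u. (\<integral>x. iexp (u * X x) \<partial>M) = complex_of_real (exp (- (u\<^sup>2 * v) / 2)))"

lemma gaussian_char_measurable: "gaussian_char M X v \<Longrightarrow> X \<in> borel_measurable M"
  by (simp add: gaussian_char_def)

lemma char_distr_gaussian:
  "gaussian_char M X v \<Longrightarrow> char (distr M borel X) u = exp (- (u\<^sup>2 * v) / 2)"
  unfolding char_def by (subst integral_distr) (auto simp: gaussian_char_def)

lemma gaussian_charI_char:
  assumes "X \<in> borel_measurable M" "\<And>u. char (distr M borel X) u = complex_of_real (exp (- (u\<^sup>2 * v) / 2))"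
  shows "gaussian_char M X v"
  unfolding gaussian_char_def
proof (intro conjI allI)
  show "(\<integral>x. iexp (u * X x) \<partial>M) = complex_of_real (exp (- (u\<^sup>2 * v) / 2))" for u
    using assms(2)[of u] assms(1) unfolding char_def by (subst (asm) integral_distr) auto
qed (fact assms(1))

lemma gaussian_char_scale:
  assumes "gaussian_char M X v"
  shows "gaussian_char M (\<lambda>x. c * X x) (c\<^sup>2 * v)"
  unfolding gaussian_char_def
proof (intro conjI allI)
  show "(\<lambda>x. c * X x) \<in> borel_measurable M" using assms by (auto simp: gaussian_char_def)
  show "(\<integral>x. iexp (u * (c * X x)) \<partial>M) = complex_of_real (exp (- (u\<^sup>2 * (c\<^sup>2 * v)) / 2))" for u
    using assms[unfolded gaussian_char_def, THEN conjunct2, rule_format, of "u * c"]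
    by (simp add: mult.assoc power_mult_distrib)
qed

lemma gaussian_char_normal:
  assumes M: "prob_space M" and s: "\<sigma> > 0" and D: "distributed M lborel X (normal_density 0 \<sigma>)"
  shows "gaussian_char M X (\<sigma>\<^sup>2)"
proof -
  interpret prob_space M by fact
  define Z where "Z x = X x / \<sigma>" for x
  have Z: "distributed M lborel Z std_normal_density"
    using D normal_standard_normal_convert[OF s, of X 0] unfolding Z_def by simp
  have Zm: "Z \<in> borel_measurable M" using distributed_measurable[OF Z] by simp
  have "gaussian_char M Z 1"
  proof (rule gaussian_charI_char[OF Zm])
    fix u
    have "distr M borel Z = distr M lborel Z" by (rule distr_cong) auto
    also have "\<dots> = std_normal_distribution" using Z by (simp add: distributed_def)
    finally show "char (distr M borel Z) u = complex_of_real (exp (- (u\<^sup>2 * 1) / 2))"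
      by (simp add: char_std_normal_distribution)
  qed
  from gaussian_char_scale[OF this, of \<sigma>] show ?thesis using s by (simp add: Z_def)
qed

lemma gaussian_char_AE_cong:
  assumes X: "gaussian_char M X v" and Y[measurable]: "Y \<in> borel_measurable M" and "AE x in M. X x = Y x"
  shows "gaussian_char M Y v"
proof -
  have [measurable]: "X \<in> borel_measurable M" using X by (rule gaussian_char_measurable)
  have "(\<integral>x. iexp (u * Y x) \<partial>M) = (\<integral>x. iexp (u * X x) \<partial>M)" for u
  proof (rule integral_cong_AE)
    show "AE x in M. iexp (u * Y x) = iexp (u * X x)" using assms(3) by eventually_elim simp
  qed measurable
  then show ?thesis using X Y by (simp add: gaussian_char_def)
qed

lemma gaussian_char_completion:
  assumes "gaussian_char M X v"
  shows "gaussian_char (completion M) X v"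
proof -
  have [measurable]: "X \<in> borel_measurable M" using assms by (rule gaussian_char_measurable)
  have "(\<integral>x. iexp (u * X x) \<partial>completion M) = (\<integral>x. iexp (u * X x) \<partial>M)" for u
    by (rule integral_completion) measurable
  then show ?thesis using assms by (auto simp: gaussian_char_def intro: measurable_completion)
qed

lemma gaussian_char_sum:
  fixes Z :: "'i \<Rightarrow> 'a \<Rightarrow> real"
  assumes M: "prob_space M" and ind: "prob_space.indep_vars M (\<lambda>_. borel) Z A"
    and Z: "\<And>i. i \<in> A \<Longrightarrow> gaussian_char M (Z i) (v i)"
  shows "gaussian_char M (\<lambda>x. \<Sum>i\<in>A. c i * Z i x) (\<Sum>i\<in>A. (c i)\<^sup>2 * v i)"
proof -
  interpret prob_space M by fact
  have cZ: "gaussian_char M (\<lambda>x. c i * Z i x) ((c i)\<^sup>2 * v i)" if "i \<in> A" for i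
    by (intro gaussian_char_scale Z that)
  have ind': "indep_vars (\<lambda>_. borel) (\<lambda>i x. c i * Z i x) A"
    by (rule indep_vars_compose2[OF ind]) simp
  show ?thesis
  proof (rule gaussian_charI_char)
    show "(\<lambda>x. \<Sum>i\<in>A. c i * Z i x) \<in> borel_measurable M"
      using cZ by (intro borel_measurable_sum) (auto simp: gaussian_char_def)
    fix u
    have "char (distr M borel (\<lambda>x. \<Sum>i\<in>A. c i * Z i x)) u = (\<Prod>i\<in>A. char (distr M borel (\<lambda>x. c i * Z i x)) u)"
      by (rule char_distr_sum[OF ind'])
    also have "\<dots> = (\<Prod>i\<in>A. complex_of_real (exp (- (u\<^sup>2 * ((c i)\<^sup>2 * v i)) / 2)))"
      by (intro prod.cong refl char_distr_gaussian cZ)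
    also have "\<dots> = complex_of_real (exp (\<Sum>i\<in>A. - (u\<^sup>2 * ((c i)\<^sup>2 * v i)) / 2))"
    proof (cases "finite A")
      case True
      then show ?thesis by (subst exp_sum) simp_all
    qed simp
    also have "(\<Sum>i\<in>A. - (u\<^sup>2 * ((c i)\<^sup>2 * v i)) / 2) = - (u\<^sup>2 * (\<Sum>i\<in>A. (c i)\<^sup>2 * v i)) / 2"
      by (simp add: sum_distrib_left sum_negf sum_divide_distrib)
    finally show "char (distr M borel (\<lambda>x. \<Sum>i\<in>A. c i * Z i x)) u = complex_of_real (exp (- (u\<^sup>2 * (\<Sum>i\<in>A. (c i)\<^sup>2 * v i)) / 2))" .
  qed
qed

text \<open>Since \<open>\<bar>exp (i u X)\<bar> = 1\<close>, dominated convergence applies to the characteristic functions.\<close>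

lemma gaussian_char_AE_limit:
  assumes M: "prob_space M"
    and X: "\<And>n. gaussian_char M (X n) (v n)" and Y[measurable]: "Y \<in> borel_measurable M"
    and lim: "AE x in M. (\<lambda>n. X n x) \<longlonglongrightarrow> Y x" and v: "v \<longlonglongrightarrow> v'"
  shows "gaussian_char M Y v'"
  unfolding gaussian_char_def
proof (intro conjI allI Y)
  interpret prob_space M by fact
  fix u
  have [measurable]: "X n \<in> borel_measurable M" for n using X[of n] by (rule gaussian_char_measurable)
  have "(\<lambda>n. \<integral>x. iexp (u * X n x) \<partial>M) \<longlonglongrightarrow> (\<integral>x. iexp (u * Y x) \<partial>M)"
  proof (rule integral_dominated_convergence[where w="\<lambda>_. 1"])
    show "AE x in M. (\<lambda>n. iexp (u * X n x)) \<longlonglongrightarrow> iexp (u * Y x)"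
      using lim by eventually_elim (intro tendsto_intros)
  qed auto
  moreover have "(\<lambda>n. \<integral>x. iexp (u * X n x) \<partial>M) \<longlonglongrightarrow> complex_of_real (exp (- (u\<^sup>2 * v') / 2))"
  proof -
    have "(\<integral>x. iexp (u * X n x) \<partial>M) = complex_of_real (exp (- (u\<^sup>2 * v n) / 2))" for n
      using X[of n] by (simp add: gaussian_char_def)
    then show ?thesis by (simp only:) (intro tendsto_intros v; simp)
  qed
  ultimately show "(\<integral>x. iexp (u * Y x) \<partial>M) = complex_of_real (exp (- (u\<^sup>2 * v') / 2))"
    by (rule LIMSEQ_unique)
qed

text \<open>Reduces to almost sure convergence along a subsequence.\<close>

lemma gaussian_char_L2_limit:
  assumes M: "prob_space M"
    and X: "\<And>n. gaussian_char M (X n) (v n)" and Y[measurable]: "Y \<in> borel_measurable M"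
    and int: "\<And>n. integrable M (\<lambda>x. (X n x - Y x)\<^sup>2)"
    and lim: "(\<lambda>n. \<integral>x. (X n x - Y x)\<^sup>2 \<partial>M) \<longlonglongrightarrow> 0" and v: "v \<longlonglongrightarrow> v'"
  shows "gaussian_char M Y v'"
proof -
  have "\<exists>r::nat\<Rightarrow>nat. strict_mono r \<and> (AE x in M. (\<lambda>n. (X (r n) x - Y x)\<^sup>2) \<longlonglongrightarrow> 0)"
    by (rule tendsto_L1_AE_subseq) (use int lim in auto)
  then obtain r :: "nat \<Rightarrow> nat" where r: "strict_mono r"
    and r0: "AE x in M. (\<lambda>n. (X (r n) x - Y x)\<^sup>2) \<longlonglongrightarrow> 0" by blast
  show ?thesis
  proof (rule gaussian_char_AE_limit[OF M _ Y])
    show "gaussian_char M (X (r n)) (v (r n))" for n by (rule X)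
    show "(\<lambda>n. v (r n)) \<longlonglongrightarrow> v'" using LIMSEQ_subseq_LIMSEQ[OF v r] by (simp add: comp_def)
    show "AE x in M. (\<lambda>n. X (r n) x) \<longlonglongrightarrow> Y x"
      using r0
    proof eventually_elim
      fix x assume "(\<lambda>n. (X (r n) x - Y x)\<^sup>2) \<longlonglongrightarrow> 0"
      then have "(\<lambda>n. sqrt ((X (r n) x - Y x)\<^sup>2)) \<longlonglongrightarrow> sqrt 0" by (rule tendsto_real_sqrt)
      then have "(\<lambda>n. X (r n) x - Y x) \<longlonglongrightarrow> 0" by (simp add: tendsto_rabs_zero_iff)
      then show "(\<lambda>n. X (r n) x) \<longlonglongrightarrow> Y x" by (simp add: LIM_zero_iff)
    qed
  qed
qed

text \<open>A characteristic function is bounded by \<open>1\<close>, which a negative \<open>v\<close> would violate.\<close>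

lemma gaussian_char_nonneg:
  assumes M: "prob_space M" and X: "gaussian_char M X v"
  shows "0 \<le> v"
proof -
  interpret prob_space M by fact
  interpret D: real_distribution "distr M borel X"
    by (intro real_distribution_distr gaussian_char_measurable[OF X])
  have "norm (char (distr M borel X) 1) \<le> 1" by (rule D.cmod_char_le_1)
  then show ?thesis by (simp add: char_distr_gaussian[OF X] norm_of_real del: of_real_exp)
qed

lemma gaussian_char_distributed:
  assumes M: "prob_space M" and X: "gaussian_char M X v" and "0 < v"
  shows "distributed M lborel X (normal_density 0 (sqrt v))"
proof -
  interpret prob_space M by fact
  let ?N = "density lborel (normal_density 0 (sqrt v))"
  have Xm: "X \<in> borel_measurable M" using X by (rule gaussian_char_measurable)
  have s: "0 < sqrt v" using assms(3) by simp
  interpret N: prob_space ?N by (rule prob_space_normal_density[OF s])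
  have Nd: "distributed ?N lborel (\<lambda>x. x) (normal_density 0 (sqrt v))"
    by (auto simp: distributed_def distr_id2 cong: distr_cong)
  have gN: "gaussian_char ?N (\<lambda>x. x) v"
    using gaussian_char_normal[OF N.prob_space_axioms s Nd] assms(3) by simp
  have rN: "distr ?N borel (\<lambda>x. x) = ?N" by (rule distr_id2) simp
  have "distr M borel X = distr ?N borel (\<lambda>x. x)"
  proof (rule Levy_uniqueness)
    show "real_distribution (distr M borel X)" by (intro real_distribution_distr Xm)
    show "real_distribution (distr ?N borel (\<lambda>x. x))" by (intro N.real_distribution_distr) simp
    show "char (distr M borel X) = char (distr ?N borel (\<lambda>x. x))"
      by (rule ext) (simp only: char_distr_gaussian[OF X] char_distr_gaussian[OF gN])
  qed
  moreover have "distr M lborel X = distr M borel X" by (rule distr_cong) auto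
  ultimately show ?thesis using Xm rN by (simp add: distributed_def)
qed

lemma gaussian_char_degenerate:
  assumes M: "prob_space M" and X: "gaussian_char M X 0"
  shows "AE x in M. X x = 0"
proof -
  interpret prob_space M by fact
  have Xm[measurable]: "X \<in> borel_measurable M" using X by (rule gaussian_char_measurable)
  have gN: "gaussian_char M (\<lambda>_. 0) 0" by (simp add: gaussian_char_def prob_space)
  have "distr M borel X = distr M borel (\<lambda>_. 0)"
  proof (rule Levy_uniqueness)
    show "char (distr M borel X) = char (distr M borel (\<lambda>_. 0))"
      by (rule ext) (simp only: char_distr_gaussian[OF X] char_distr_gaussian[OF gN])
  qed (intro real_distribution_distr; simp)+
  moreover have "AE y in distr M borel (\<lambda>_. 0 :: real). y = 0"
    by (subst AE_distr_iff) auto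
  ultimately have "AE y in distr M borel X. y = 0" by (simp only:)
  then show ?thesis by (subst (asm) AE_distr_iff) auto
qed

lemma gaussian_char_imp_centered_gaussian:
  assumes M: "prob_space M" and X: "gaussian_char M X v"
  shows "centered_gaussian M X"
proof (cases "v = 0")
  case True
  then show ?thesis using gaussian_char_degenerate[OF M] X by (auto simp: centered_gaussian_def gaussian_char_def)
next
  case False
  then have "0 < v" using gaussian_char_nonneg[OF M X] by simp
  then show ?thesis using gaussian_char_distributed[OF M X] X
    unfolding centered_gaussian_def gaussian_char_def
    by (metis real_sqrt_gt_zero)
qed

lemma gaussian_char_second_moment:
  assumes M: "prob_space M" and X: "gaussian_char M X v"
  shows "square_integrable M X" and "(\<integral>x. (X x)\<^sup>2 \<partial>M) = v"
proof -
  interpret prob_space M by fact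
  have Xm[measurable]: "X \<in> borel_measurable M" using X by (rule gaussian_char_measurable)
  have "integrable M (\<lambda>x. (X x)\<^sup>2) \<and> (\<integral>x. (X x)\<^sup>2 \<partial>M) = v"
  proof (cases "v = 0")
    case True
    then have "AE x in M. (X x)\<^sup>2 = 0" using gaussian_char_degenerate[OF M] X by auto
    then have "integrable M (\<lambda>x. (X x)\<^sup>2) \<longleftrightarrow> integrable M (\<lambda>x. 0::real)"
      "(\<integral>x. (X x)\<^sup>2 \<partial>M) = (\<integral>x. 0 \<partial>M)"
      by (intro integrable_cong_AE integral_cong_AE; simp)+
    then show ?thesis using True by simp
  next
    case False
    then have v: "0 < v" "0 < sqrt v" using gaussian_char_nonneg[OF M X] by auto
    note D = gaussian_char_distributed[OF M X v(1)]
    have "integrable M (\<lambda>x. (X x)\<^sup>2)"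
      using integrable_normal_moment[OF v(2), of 0 2] distributed_integrable[OF D, of "\<lambda>x. x\<^sup>2"] by simp
    moreover have "(\<integral>x. (X x)\<^sup>2 \<partial>M) = v"
      using normal_distributed_variance[OF v(2) D] normal_distributed_expectation[OF v(2) D] v by simp
    ultimately show ?thesis ..
  qed
  then show "square_integrable M X" "(\<integral>x. (X x)\<^sup>2 \<partial>M) = v" by (auto simp: square_integrable_def)
qed

text \<open>The quantity compared in \<open>process_law_eqI\<close>; it depends on the variance only.\<close>

lemma gaussian_char_expectation_cos:
  assumes M: "prob_space M" and X: "gaussian_char M X v"
  shows "(\<integral>x. cos (X x + a) \<partial>M) = exp (- v / 2) * cos a"
proof -
  interpret prob_space M by fact
  have [measurable]: "X \<in> borel_measurable M" using X by (rule gaussian_char_measurable)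
  have "(\<integral>x. iexp (X x) \<partial>M) = complex_of_real (exp (- v / 2))"
    using X[unfolded gaussian_char_def, THEN conjunct2, rule_format, of 1] by simp
  then have "complex_of_real (exp (- v / 2)) * iexp a = (\<integral>x. iexp (X x) * iexp a \<partial>M)" by simp
  also have "\<dots> = (\<integral>x. iexp (X x + a) \<partial>M)" by (simp add: exp_add[symmetric] algebra_simps)
  finally have "Re (complex_of_real (exp (- v / 2)) * iexp a) = Re (\<integral>x. iexp (X x + a) \<partial>M)" by simp
  also have "\<dots> = (\<integral>x. Re (iexp (X x + a)) \<partial>M)"
    by (subst integral_Re) (auto intro!: integrable_iexp)
  finally show ?thesis by (simp add: cis_conv_exp[symmetric] flip: of_real_add)
qed

section \<open>The mean-centered Wiener process\<close>

text \<open>Writing \<open>f k - f 0\<close> as a sum over all \<open>i < n\<close> with a cutoff depending on the value \<open>t k\<close>, and not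
  on the index \<open>k\<close>, allows several points of the grid to share one family of increments.\<close>

lemma sum_increments_below:
  fixes f :: "nat \<Rightarrow> real" and t :: "nat \<Rightarrow> real"
  assumes mono: "\<And>i j. i < j \<Longrightarrow> j \<le> n \<Longrightarrow> t i < t j" and k: "k \<le> n"
  shows "(\<Sum>i<n. (if t i < t k then 1 else 0) * (f (Suc i) - f i)) = f k - f 0"
proof -
  have "t i < t k \<longleftrightarrow> i < k" if "i < n" for i
    using mono[of i k] mono[of k i] that k by (cases i k rule: linorder_cases) auto
  then have "(\<Sum>i<n. (if t i < t k then 1 else 0) * (f (Suc i) - f i)) = (\<Sum>i<n. if i < k then f (Suc i) - f i else 0)"
    by (intro sum.cong) auto
  also have "\<dots> = (\<Sum>i<k. f (Suc i) - f i)"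
    using k by (intro sum.mono_neutral_cong_right) auto
  finally show ?thesis by (simp add: sum_lessThan_telescope)
qed

text \<open>All points \<open>\<tau> j\<close> are placed on one sorted grid starting at \<open>0\<close>. Each \<open>W (\<tau> j)\<close> is then the sum of
  the independent increments \<open>Z\<^sub>i\<close> below \<open>\<tau> j\<close>, that is \<open>\<Sum> d i (\<tau> j) Z\<^sub>i\<close> with a \<open>0/1\<close> cutoff \<open>d\<close>. The
  covariance \<open>min\<close> arises because the product of two cutoffs is the cutoff at the minimum. Indexing
  by a family \<open>\<tau>\<close> lets observation times coincide with nodes of a Riemann sum.\<close>

lemma wiener_combination_gaussian:
  fixes \<tau> :: "'i \<Rightarrow> real" and c :: "'i \<Rightarrow> real"
  assumes W: "standard_wiener M W" and J: "finite J" and \<tau>: "\<And>j. j \<in> J \<Longrightarrow> 0 \<le> \<tau> j"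
  shows "gaussian_char M (\<lambda>x. \<Sum>j\<in>J. c j * W (\<tau> j) x) (\<Sum>i\<in>J. \<Sum>j\<in>J. c i * c j * min (\<tau> i) (\<tau> j))"
proof -
  from W interpret prob_space M by (simp add: standard_wiener_def)
  \<comment> \<open>The point \<open>0\<close> is included because \<open>W 0\<close> vanishes almost surely, so increments from it recover \<open>W\<close>.\<close>
  define S where "S = insert 0 (\<tau> ` J)"
  define L where "L = sorted_list_of_set S"
  define t where "t i = L ! i" for i
  define n where "n = length L - 1"
  have S: "finite S" "S \<noteq> {}" "\<And>s. s \<in> S \<Longrightarrow> 0 \<le> s" using J \<tau> by (auto simp: S_def)
  have L: "set L = S" "sorted_wrt (<) L" using S by (simp_all add: L_def)
  have "L \<noteq> []" using L S by auto
  then have lenL: "length L = Suc n" by (simp add: n_def)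
  have mono: "t i < t j" if "i < j" "j \<le> n" for i j
    using sorted_wrt_nth_less[OF L(2)] that lenL by (simp add: t_def)
  have idx: "\<exists>k\<le>n. s = t k" if "s \<in> S" for s
    using that L(1) lenL unfolding t_def in_set_conv_nth by (metis in_set_conv_nth less_Suc_eq_le)
  have t_pos: "0 \<le> t i" if "i \<le> n" for i
    using that lenL L(1) S(3)[of "t i"] nth_mem[of i L] by (simp add: t_def)
  have t0: "t 0 = 0"
  proof -
    obtain k where "k \<le> n" "0 = t k" using idx[of 0] by (auto simp: S_def)
    then show ?thesis using mono[of 0 k] t_pos[of 0] by (cases "k = 0") auto
  qed
  define Z where "Z i x = W (t (Suc i)) x - W (t i) x" for i x
  define d where "d i s = (if t i < s then 1 else 0 :: real)" for i s
  have Zg: "gaussian_char M (Z i) (t (Suc i) - t i)" if "i < n" for i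
  proof -
    have "0 \<le> t i" "t i < t (Suc i)" using t_pos[of i] mono[of i "Suc i"] that by auto
    moreover then have "distributed M lborel (Z i) (normal_density 0 (sqrt (t (Suc i) - t i)))"
      using W unfolding standard_wiener_def Z_def by blast
    ultimately show ?thesis
      using gaussian_char_normal[OF prob_space_axioms, of "sqrt (t (Suc i) - t i)" "Z i"] by simp
  qed
  have ind: "indep_vars (\<lambda>_. borel) Z {..<n}"
  proof -
    have "0 \<le> t 0 \<and> (\<forall>i<n. t i < t (Suc i))" using t0 mono by auto
    then show ?thesis using W unfolding standard_wiener_def Z_def by blast
  qed
  define C where "C i = (\<Sum>j\<in>J. c j * d i (\<tau> j))" for i
  have "gaussian_char M (\<lambda>x. \<Sum>i<n. C i * Z i x) (\<Sum>i<n. (C i)\<^sup>2 * (t (Suc i) - t i))"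
    by (rule gaussian_char_sum[OF prob_space_axioms ind]) (simp add: Zg)
  moreover have "(\<Sum>i<n. (C i)\<^sup>2 * (t (Suc i) - t i)) = (\<Sum>i\<in>J. \<Sum>j\<in>J. c i * c j * min (\<tau> i) (\<tau> j))"
  proof -
    \<comment> \<open>The telescoping lemma is applied to the grid points themselves: the variances of the increments below \<open>min s s'\<close> add up to \<open>min s s'\<close>.\<close>
    have dd: "(\<Sum>i<n. d i s * d i s' * (t (Suc i) - t i)) = min s s'" if "s \<in> S" "s' \<in> S" for s s'
    proof -
      have "min s s' \<in> S" using that by (simp add: min_def)
      then obtain k where k: "k \<le> n" "min s s' = t k" using idx by blast
      have "d i s * d i s' = (if t i < t k then 1 else 0)" for i by (auto simp: d_def k(2)[symmetric])
      then show ?thesis using sum_increments_below[of n t k t, OF mono k(1)] k(2) t0 by simp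
    qed
    have "(\<Sum>i<n. (C i)\<^sup>2 * (t (Suc i) - t i))
        = (\<Sum>i<n. \<Sum>a\<in>J. \<Sum>b\<in>J. c a * c b * (d i (\<tau> a) * d i (\<tau> b) * (t (Suc i) - t i)))"
      unfolding C_def power2_eq_square sum_product unfolding sum_distrib_right
      by (intro sum.cong refl) (simp add: mult_ac)
    also have "\<dots> = (\<Sum>a\<in>J. \<Sum>b\<in>J. \<Sum>i<n. c a * c b * (d i (\<tau> a) * d i (\<tau> b) * (t (Suc i) - t i)))"
      by (subst sum.swap, intro sum.cong refl, rule sum.swap)
    also have "\<dots> = (\<Sum>a\<in>J. \<Sum>b\<in>J. c a * c b * min (\<tau> a) (\<tau> b))"
      by (intro sum.cong refl) (simp add: sum_distrib_left[symmetric] dd S_def)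
    finally show ?thesis .
  qed
  ultimately have g: "gaussian_char M (\<lambda>x. \<Sum>i<n. C i * Z i x) (\<Sum>i\<in>J. \<Sum>j\<in>J. c i * c j * min (\<tau> i) (\<tau> j))"
    by simp
  show ?thesis
  proof (rule gaussian_char_AE_cong[OF g])
    show "(\<lambda>x. \<Sum>j\<in>J. c j * W (\<tau> j) x) \<in> borel_measurable M"
      using W \<tau> by (intro borel_measurable_sum borel_measurable_times borel_measurable_const)
        (simp add: standard_wiener_def)
    have "AE x in M. W 0 x = 0" using W by (simp add: standard_wiener_def)
    then show "AE x in M. (\<Sum>i<n. C i * Z i x) = (\<Sum>j\<in>J. c j * W (\<tau> j) x)"
    proof eventually_elim
      fix x assume W0: "W 0 x = 0"
      have Wd: "(\<Sum>i<n. d i s * Z i x) = W s x" if "s \<in> S" for s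
      proof -
        obtain k where k: "k \<le> n" "s = t k" using idx[OF \<open>s \<in> S\<close>] by blast
        show ?thesis
          using sum_increments_below[of n t k "\<lambda>i. W (t i) x", OF mono k(1)] W0 t0
          by (simp add: d_def Z_def k)
      qed
      have "(\<Sum>i<n. C i * Z i x) = (\<Sum>i<n. \<Sum>j\<in>J. c j * (d i (\<tau> j) * Z i x))"
        by (simp add: C_def sum_distrib_right mult.assoc)
      also have "\<dots> = (\<Sum>j\<in>J. \<Sum>i<n. c j * (d i (\<tau> j) * Z i x))" by (rule sum.swap)
      also have "\<dots> = (\<Sum>j\<in>J. c j * W (\<tau> j) x)"
        by (intro sum.cong refl) (simp add: sum_distrib_left[symmetric] Wd S_def)
      finally show "(\<Sum>i<n. C i * Z i x) = (\<Sum>j\<in>J. c j * W (\<tau> j) x)" .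
    qed
  qed
qed

text \<open>By the mean value theorem for the primitive \<open>F\<close>, the integral over a cell of length \<open>1/n\<close> is
  \<open>f \<xi> / n\<close> for some \<open>\<xi>\<close> in the cell, and uniform continuity compares \<open>f \<xi>\<close> with the value at the
  right end point.\<close>

lemma Riemann_sum_tendsto_integral:
  fixes f :: "real \<Rightarrow> real"
  assumes f: "continuous_on {0..1} f"
  shows "(\<lambda>n. (\<Sum>k=1..n. f (real k / real n)) / real n) \<longlonglongrightarrow> integral {0..1} f"
proof (rule LIMSEQ_I)
  fix e :: real assume "e > 0"
  have "uniformly_continuous_on {0..1} f" using f by (intro compact_uniformly_continuous) auto
  then obtain d where d: "d > 0" "\<And>x y. x \<in> {0..1} \<Longrightarrow> y \<in> {0..1} \<Longrightarrow> dist y x < d \<Longrightarrow> dist (f y) (f x) < e"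
    using \<open>e > 0\<close> unfolding uniformly_continuous_on_def by meson
  obtain N :: nat where N: "N > 0" "1 / real N < d"
    using d(1) real_arch_inverse[of d] by (auto simp: inverse_eq_divide)
  define F where "F x = integral {0..x} f" for x
  have "\<bar>(\<Sum>k=1..n. f (real k / real n)) / real n - integral {0..1} f\<bar> < e" if "n \<ge> N" for n
  proof -
    have n: "n > 0" "1 / real n < d" using N that
      by (auto intro!: le_less_trans[of "1 / real n" "1 / real N"] divide_left_mono)
    have step: "\<bar>f (real (Suc i) / n) / n - (F (real (Suc i) / n) - F (real i / n))\<bar> < e / n" if i: "i < n" for i
    proof -
      have ab: "real i / n < real (Suc i) / n" "0 \<le> real i / n" "real (Suc i) / n \<le> 1"
        using i n by (auto simp: field_simps)
      have "\<exists>x\<in>{real i / n <..< real (Suc i) / n}. F (real (Suc i) / n) - F (real i / n) = (\<lambda>y. f x * y) (real (Suc i) / n - real i / n)"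
      proof (rule mvt_simple[OF ab(1)])
        fix x assume x: "real i / n \<le> x" "x \<le> real (Suc i) / n"
        then have "(F has_real_derivative f x) (at x within {0..1})"
          unfolding F_def using order_trans[OF ab(2) x(1)] order_trans[OF x(2) ab(3)]
          by (intro integral_has_real_derivative f) auto
        then have "(F has_real_derivative f x) (at x within {real i / n .. real (Suc i) / n})"
          by (rule has_field_derivative_subset) (use ab in auto)
        then show "(F has_derivative (\<lambda>y. f x * y)) (at x within {real i / n .. real (Suc i) / n})"
          by (simp add: has_field_derivative_def)
      qed
      then obtain x where x: "real i / n < x" "x < real (Suc i) / n"
        and Fx: "F (real (Suc i) / n) - F (real i / n) = f x * (real (Suc i) / n - real i / n)" by auto
      have diff: "real (Suc i) / n - real i / n = 1 / n"
        unfolding diff_divide_distrib[symmetric] by simp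
      have "dist (f (real (Suc i) / n)) (f x) < e"
      proof (rule d(2))
        show "dist (real (Suc i) / n) x < d" using x diff n(2) by (simp add: dist_real_def)
      qed (use x ab order_trans[OF ab(2) less_imp_le[OF x(1)]] in auto)
      then have "\<bar>f (real (Suc i) / n) - f x\<bar> / n < e / n"
        using n by (simp add: dist_real_def divide_strict_right_mono)
      also have "\<bar>f (real (Suc i) / n) - f x\<bar> / n = \<bar>f (real (Suc i) / n) / n - f x * (1 / n)\<bar>"
        using n by (simp add: diff_divide_distrib[symmetric])
      finally show ?thesis unfolding Fx diff .
    qed
    have "(\<Sum>k=1..n. f (real k / n)) / n - integral {0..1} f = (\<Sum>i<n. f (real (Suc i) / n) / n) - (F (real n / n) - F (real 0 / n))"
      using n by (simp add: F_def sum_divide_distrib[symmetric] sum.atLeast_Suc_atMost_Suc_shift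
           sum.atLeast1_atMost_eq lessThan_atLeast0)
    also have "\<dots> = (\<Sum>i<n. f (real (Suc i) / n) / n - (F (real (Suc i) / n) - F (real i / n)))"
      unfolding sum_lessThan_telescope[of "\<lambda>i. F (real i / n)" n, symmetric] by (simp only: sum_subtractf)
    also have "\<bar>\<dots>\<bar> \<le> (\<Sum>i<n. \<bar>f (real (Suc i) / n) / n - (F (real (Suc i) / n) - F (real i / n))\<bar>)"
      by (rule sum_abs)
    also have "\<dots> < (\<Sum>i<n. e / n)"
      using n step by (intro sum_strict_mono) auto
    also have "\<dots> = e" using n by simp
    finally show ?thesis .
  qed
  then show "\<exists>no. \<forall>n\<ge>no. norm ((\<Sum>k=1..n. f (real k / real n)) / real n - integral {0..1} f) < e"
    by auto
qed

lemma sum_min_squares: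
  "(\<Sum>k=1..n. \<Sum>l=1..n. min (real k) (real l)) = real n * (real n + 1) * (2 * real n + 1) / 6"
proof (induction n)
  case (Suc n)
  have "(\<Sum>k=1..Suc n. \<Sum>l=1..Suc n. min (real k) (real l))
      = (\<Sum>k=1..n. (\<Sum>l=1..n. min (real k) (real l)) + real k) + ((\<Sum>l=1..n. real l) + real (Suc n))"
    by simp
  also have "\<dots> = (\<Sum>k=1..n. \<Sum>l=1..n. min (real k) (real l)) + 2 * (\<Sum>l=1..n. real l) + real (Suc n)"
    by (simp add: sum.distrib)
  also have "(\<Sum>l=1..n. real l) = real n * (real n + 1) / 2"
    by (induction n) (auto simp: field_simps)
  finally show ?case using Suc.IH by (simp add: field_simps)
qed simp

lemma integral_min:
  assumes "s \<in> {0..1::real}"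
  shows "integral {0..1} (\<lambda>u. min s u) = s - s\<^sup>2 / 2"
proof -
  have "((\<lambda>u. min s u) has_integral (s\<^sup>2 / 2 - 0\<^sup>2 / 2)) {0..s}"
  proof (rule has_integral_eq)
    show "((\<lambda>u. u) has_integral (s\<^sup>2 / 2 - 0\<^sup>2 / 2)) {0..s}"
      using assms by (intro fundamental_theorem_of_calculus)
        (auto intro!: derivative_eq_intros simp flip: has_real_derivative_iff_has_vector_derivative)
  qed auto
  moreover have "((\<lambda>u. min s u) has_integral (s * 1 - s * s)) {s..1}"
  proof (rule has_integral_eq)
    show "((\<lambda>u. s) has_integral (s * 1 - s * s)) {s..1}"
      using assms has_integral_const_real[of s s 1] by (simp add: algebra_simps)
  qed auto
  ultimately have "((\<lambda>u. min s u) has_integral (s\<^sup>2 / 2 - 0\<^sup>2 / 2) + (s * 1 - s * s)) {0..1}"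
    using assms by (intro has_integral_combine) auto
  then show ?thesis by (simp add: integral_unique power2_eq_square)
qed

text \<open>Used for the path integral, which agrees with a limit of measurable Riemann sums only almost
  surely.\<close>

lemma borel_measurable_completion_AE:
  fixes f g :: "'a \<Rightarrow> real"
  assumes g: "g \<in> borel_measurable M" and eq: "AE x in M. f x = g x"
  shows "f \<in> borel_measurable (completion M)"
proof (rule measurableI)
  fix A :: "real set" assume A: "A \<in> sets borel"
  have "AE x in completion M. x \<in> g -` A \<inter> space M \<longleftrightarrow> x \<in> f -` A \<inter> space (completion M)"
    using AE_completion[OF eq] by eventually_elim auto
  moreover have "g -` A \<inter> space M \<in> sets (completion M)"
    using measurable_sets[OF g A] by auto
  ultimately show "f -` A \<inter> space (completion M) \<in> sets (completion M)"
    by (rule completion.in_sets_AE) simp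
qed simp

text \<open>The covariance of \<open>W s - \<integral>W\<close> and \<open>W t - \<integral>W\<close>: the covariance \<open>min s t\<close> of \<open>W\<close>, minus
  \<open>E(W s \<integral>W) = s - s\<^sup>2/2\<close> and \<open>E(W t \<integral>W) = t - t\<^sup>2/2\<close>, plus \<open>E((\<integral>W)\<^sup>2) = 1/3\<close>.\<close>

definition centered_wiener_kernel :: "real \<Rightarrow> real \<Rightarrow> real" where
  "centered_wiener_kernel s t = 1 / 3 - max s t + (s\<^sup>2 + t\<^sup>2) / 2"

lemma mean_centered_AE_limit:
  assumes W: "standard_wiener M W"
  shows "AE x in M. (\<lambda>n. (\<Sum>k=1..n. W (real k / real n) x) / real n) \<longlonglongrightarrow> (LINT u:{0..1}|lborel. W u x)"
proof -
  have "AE x in M. continuous_on {0..} (\<lambda>t. W t x)" using W by (simp add: standard_wiener_def)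
  then show ?thesis
  proof eventually_elim
    fix x assume "continuous_on {0..} (\<lambda>t. W t x)"
    then have c: "continuous_on {0..1} (\<lambda>t. W t x)" by (rule continuous_on_subset) auto
    have "(LINT u:{0..1}|lborel. W u x) = integral {0..1} (\<lambda>u. W u x)"
      by (rule set_borel_integral_eq_integral) (rule borel_integrable_atLeastAtMost'[OF c])
    then show "(\<lambda>n. (\<Sum>k=1..n. W (real k / real n) x) / real n) \<longlonglongrightarrow> (LINT u:{0..1}|lborel. W u x)"
      using Riemann_sum_tendsto_integral[OF c] by simp
  qed
qed

lemma mean_centered_measurable:
  assumes W: "standard_wiener M W" and t: "0 \<le> t"
  shows "mean_centered W t \<in> borel_measurable (completion M)"
proof -
  have Wm: "W s \<in> borel_measurable M" if "0 \<le> s" for s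
    using W that unfolding standard_wiener_def by blast
  define I where "I x = lim (\<lambda>n. (\<Sum>k=1..n. W (real k / real n) x) / real n)" for x
  have "(\<lambda>x. (\<Sum>k=1..n. W (real k / real n) x) / real n) \<in> borel_measurable M" for n
    by (intro borel_measurable_divide borel_measurable_sum borel_measurable_const Wm) simp
  then have Im: "I \<in> borel_measurable M"
    unfolding I_def by (rule borel_measurable_lim_metric)
  have "AE x in M. mean_centered W t x = W t x - I x"
    using mean_centered_AE_limit[OF W]
    by eventually_elim (simp add: mean_centered_def I_def limI)
  moreover have "(\<lambda>x. W t x - I x) \<in> borel_measurable M" using Wm[OF t] Im by (rule borel_measurable_diff)
  ultimately show ?thesis by (intro borel_measurable_completion_AE)
qed

text \<open>Replacing \<open>\<integral>W\<close> by its \<open>n\<close>-th Riemann sum turns the combination into a combination \<open>X\<^sub>n\<close> of values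
  of \<open>W\<close>, indexed by the disjoint union of \<open>J\<close> and the nodes \<open>1, \<dots>, n\<close>. Its variance splits
  into a part over \<open>J \<times> J\<close>, two mixed parts and a part over pairs of nodes; the mixed parts
  are built from Riemann sums of \<open>u \<mapsto> min s u\<close>, with limit \<open>s - s\<^sup>2/2\<close>, and the last part has a closed
  form by \<open>sum_min_squares\<close>, in which \<open>C\<^sup>2\<close> is multiplied by a factor tending to \<open>1/3\<close>.\<close>

lemma mean_centered_gaussian:
  assumes W: "standard_wiener M W" and J: "finite J" "J \<subseteq> {0..1}"
  shows "gaussian_char (completion M) (\<lambda>x. \<Sum>t\<in>J. c t * mean_centered W t x)
     (\<Sum>s\<in>J. \<Sum>t\<in>J. c s * c t * centered_wiener_kernel s t)"
proof -
  from W interpret prob_space M by (simp add: standard_wiener_def)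
  \<comment> \<open>The path integral enters the combination with total coefficient \<open>- C\<close>, shared equally by the nodes.\<close>
  define C where "C = (\<Sum>t\<in>J. c t)"
  define cc where "cc n = case_sum c (\<lambda>k::nat. - C / real n)" for n :: nat
  define \<tau> where "\<tau> n = case_sum (\<lambda>t::real. t) (\<lambda>k::nat. real k / real n)" for n :: nat
  define X where "X n x = (\<Sum>j\<in>J <+> {1..n}. cc n j * W (\<tau> n j) x)" for n x
  define v where "v n = (\<Sum>i\<in>J <+> {1..n}. \<Sum>j\<in>J <+> {1..n}. cc n i * cc n j * min (\<tau> n i) (\<tau> n j))" for n
  have Xg: "gaussian_char M (X n) (v n)" for n
    unfolding X_def v_def using J
    by (intro wiener_combination_gaussian[OF W]) (auto simp: \<tau>_def split: sum.splits)
  have Xeq: "X n x = (\<Sum>t\<in>J. c t * W t x) - C * ((\<Sum>k=1..n. W (real k / real n) x) / real n)" for n x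
    unfolding X_def using J
    by (subst sum.Plus) (simp_all add: cc_def \<tau>_def sum_distrib_left sum_negf sum_divide_distrib)
  have lim: "AE x in M. (\<lambda>n. X n x) \<longlonglongrightarrow> (\<Sum>t\<in>J. c t * mean_centered W t x)"
    using mean_centered_AE_limit[OF W]
  proof eventually_elim
    fix x assume l: "(\<lambda>n. (\<Sum>k=1..n. W (real k / real n) x) / real n) \<longlonglongrightarrow> (LINT u:{0..1}|lborel. W u x)"
    have "(\<Sum>t\<in>J. c t * mean_centered W t x) = (\<Sum>t\<in>J. c t * W t x) - C * (LINT u:{0..1}|lborel. W u x)"
      by (simp add: mean_centered_def C_def right_diff_distrib sum_subtractf sum_distrib_right)
    then show "(\<lambda>n. X n x) \<longlonglongrightarrow> (\<Sum>t\<in>J. c t * mean_centered W t x)"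
      unfolding Xeq \<open>(\<Sum>t\<in>J. c t * mean_centered W t x) = _\<close> by (intro tendsto_intros l)
  qed
  define m where "m n s = (\<Sum>k=1..n. min s (real k / real n)) / real n" for n :: nat and s
  have veq: "v n = (\<Sum>s\<in>J. \<Sum>t\<in>J. c s * c t * min s t) - 2 * C * (\<Sum>s\<in>J. c s * m n s)
       + C\<^sup>2 * ((\<Sum>k=1..n. \<Sum>l=1..n. min (real k / real n) (real l / real n)) / (real n)\<^sup>2)" for n
  proof -
    have cross: "(\<Sum>s\<in>J. \<Sum>k=1..n. c s * (- C / real n) * min s (real k / real n)) = - (C * (\<Sum>s\<in>J. c s * m n s))"
      by (simp add: m_def sum_distrib_left sum_divide_distrib sum_negf mult_ac)
    have cross': "(\<Sum>k=1..n. \<Sum>s\<in>J. (- C / real n) * c s * min (real k / real n) s) = - (C * (\<Sum>s\<in>J. c s * m n s))"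
      unfolding cross[symmetric] by (subst sum.swap) (simp add: min.commute mult.commute)
    have diag: "(\<Sum>k=1..n. \<Sum>l=1..n. (- C / real n) * (- C / real n) * min (real k / real n) (real l / real n))
      = C\<^sup>2 * ((\<Sum>k=1..n. \<Sum>l=1..n. min (real k / real n) (real l / real n)) / (real n)\<^sup>2)"
      by (simp add: sum_distrib_left sum_divide_distrib power2_eq_square)
    have "v n = (\<Sum>s\<in>J. (\<Sum>t\<in>J. c s * c t * min s t) + (\<Sum>k=1..n. c s * (- C / real n) * min s (real k / real n)))
       + (\<Sum>k=1..n. (\<Sum>s\<in>J. (- C / real n) * c s * min (real k / real n) s)
          + (\<Sum>l=1..n. (- C / real n) * (- C / real n) * min (real k / real n) (real l / real n)))"
      unfolding v_def using J by (simp add: sum.Plus cc_def \<tau>_def o_def)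
    also have "\<dots> = (\<Sum>s\<in>J. \<Sum>t\<in>J. c s * c t * min s t) + - (C * (\<Sum>s\<in>J. c s * m n s))
       + (- (C * (\<Sum>s\<in>J. c s * m n s)) +
          C\<^sup>2 * ((\<Sum>k=1..n. \<Sum>l=1..n. min (real k / real n) (real l / real n)) / (real n)\<^sup>2))"
      unfolding sum.distrib cross cross' diag ..
    finally show ?thesis by simp
  qed
  have mlim: "(\<lambda>n. m n s) \<longlonglongrightarrow> s - s\<^sup>2 / 2" if "s \<in> J" for s
  proof -
    have s: "s \<in> {0..1}" using J that by auto
    have "continuous_on {0..1} (\<lambda>u. min s u)" by (intro continuous_intros)
    from Riemann_sum_tendsto_integral[OF this] show ?thesis
      unfolding m_def integral_min[OF s] .
  qed
  have dlim: "(\<lambda>n. (\<Sum>k=1..n. \<Sum>l=1..n. min (real k / real n) (real l / real n)) / (real n)\<^sup>2) \<longlonglongrightarrow> 1 / 3"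
  proof -
    have "(\<lambda>n. (1 + 1 / real n) * (2 + 1 / real n) / 6) \<longlonglongrightarrow> (1 + 0) * (2 + 0) / 6"
      by (intro tendsto_intros lim_1_over_n) simp
    also have "(1 + 0) * (2 + 0) / 6 = (1 / 3 :: real)" by simp
    finally have "(\<lambda>n. (1 + 1 / real n) * (2 + 1 / real n) / 6) \<longlonglongrightarrow> 1 / 3" .
    moreover have "eventually (\<lambda>n. (1 + 1 / real n) * (2 + 1 / real n) / 6
        = (\<Sum>k=1..n. \<Sum>l=1..n. min (real k / real n) (real l / real n)) / (real n)\<^sup>2) sequentially"
      using eventually_gt_at_top[of 0]
    proof eventually_elim
      fix n :: nat assume n: "0 < n"
      then have "min (real k / real n) (real l / real n) = min (real k) (real l) / real n" for k l
        by (simp add: min_def divide_le_cancel)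
      then have "(\<Sum>k=1..n. \<Sum>l=1..n. min (real k / real n) (real l / real n)) = (\<Sum>k=1..n. \<Sum>l=1..n. min (real k) (real l)) / real n"
        by (simp add: sum_divide_distrib)
      then show "(1 + 1 / real n) * (2 + 1 / real n) / 6
        = (\<Sum>k=1..n. \<Sum>l=1..n. min (real k / real n) (real l / real n)) / (real n)\<^sup>2"
        using n unfolding sum_min_squares by (simp add: field_simps power2_eq_square)
    qed
    ultimately show ?thesis by (rule Lim_transform_eventually)
  qed
  have "v \<longlonglongrightarrow> (\<Sum>s\<in>J. \<Sum>t\<in>J. c s * c t * min s t) - 2 * C * (\<Sum>s\<in>J. c s * (s - s\<^sup>2 / 2)) + C\<^sup>2 * (1 / 3)"
    unfolding veq[abs_def] by (intro tendsto_intros mlim dlim)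
  also have "(\<Sum>s\<in>J. \<Sum>t\<in>J. c s * c t * min s t) - 2 * C * (\<Sum>s\<in>J. c s * (s - s\<^sup>2 / 2)) + C\<^sup>2 * (1 / 3)
      = (\<Sum>s\<in>J. \<Sum>t\<in>J. c s * c t * centered_wiener_kernel s t)"
  proof -
    have a: "C * (\<Sum>s\<in>J. c s * (s - s\<^sup>2 / 2)) = (\<Sum>s\<in>J. \<Sum>t\<in>J. c s * c t * (t - t\<^sup>2 / 2))"
      by (simp add: C_def sum_product mult_ac)
    have b: "C * (\<Sum>s\<in>J. c s * (s - s\<^sup>2 / 2)) = (\<Sum>s\<in>J. \<Sum>t\<in>J. c s * c t * (s - s\<^sup>2 / 2))"
      unfolding a by (subst sum.swap) (simp add: mult_ac)
    have d: "C\<^sup>2 * (1 / 3) = (\<Sum>s\<in>J. \<Sum>t\<in>J. c s * c t * (1 / 3))"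
      by (simp add: C_def power2_eq_square sum_product sum_divide_distrib)
    have k: "c s * c t * centered_wiener_kernel s t = c s * c t * min s t - c s * c t * (t - t\<^sup>2 / 2) - c s * c t * (s - s\<^sup>2 / 2) + c s * c t * (1 / 3)" for s t
      by (simp add: centered_wiener_kernel_def min_def max_def algebra_simps)
    show ?thesis unfolding k sum.distrib sum_subtractf a[symmetric] b[symmetric] d[symmetric] by simp
  qed
  finally have vlim: "v \<longlonglongrightarrow> (\<Sum>s\<in>J. \<Sum>t\<in>J. c s * c t * centered_wiener_kernel s t)" .
  show ?thesis
  proof (rule gaussian_char_AE_limit[OF prob_space_completion gaussian_char_completion[OF Xg] _ AE_completion[OF lim] vlim])
    show "(\<lambda>x. \<Sum>t\<in>J. c t * mean_centered W t x) \<in> borel_measurable (completion M)"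
      using J by (intro borel_measurable_sum borel_measurable_times borel_measurable_const mean_centered_measurable[OF W]) auto
  qed
qed

section \<open>The covariance kernel as a cosine series\<close>

text \<open>From the factorization \<open>1 - cis x = 2 sin (x/2) cis ((x - \<pi>)/2)\<close>, where \<open>sin (x/2) > 0\<close>.\<close>

lemma Im_Ln_one_minus_cis:
  assumes "0 < x" "x < 2 * pi"
  shows "Im (Ln (1 - cis x)) = (x - pi) / 2" and "1 - cis x \<notin> \<real>\<^sub>\<le>\<^sub>0"
proof -
  have s: "sin (x / 2) > 0" using assms by (intro sin_gt_zero) auto
  have c: "cos x = 1 - 2 * (sin (x / 2))\<^sup>2" "sin x = 2 * sin (x / 2) * cos (x / 2)"
    using cos_double_sin[of "x / 2"] sin_double[of "x / 2"] by simp_all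
  have "cos (x / 2 - pi / 2) = sin (x / 2)" "sin (x / 2 - pi / 2) = - cos (x / 2)"
    by (simp_all add: cos_diff sin_diff)
  then have eq: "of_real (2 * sin (x / 2)) * cis ((x - pi) / 2) = 1 - cis x"
    using c by (simp add: complex_eq_iff diff_divide_distrib power2_eq_square)
  have "exp (Complex (ln (2 * sin (x / 2))) ((x - pi) / 2)) = 1 - cis x"
    unfolding eq[symmetric] using s by (simp add: exp_eq_polar)
  then have "Ln (1 - cis x) = Complex (ln (2 * sin (x / 2))) ((x - pi) / 2)"
    using assms by (intro Ln_unique) auto
  then show "Im (Ln (1 - cis x)) = (x - pi) / 2" by simp
  have "0 < Re (1 - cis x)" using c(1) s by simp
  then show "1 - cis x \<notin> \<real>\<^sub>\<le>\<^sub>0" by (auto simp: complex_nonpos_Reals_iff)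
qed

lemma summable_inverse_Suc_squares: "summable (\<lambda>n. 1 / (real (Suc n))\<^sup>2)"
  using inverse_squares_sums by (simp add: sums_iff add.commute)

text \<open>The imaginary part of the Taylor series of \<open>Ln (1 - z)\<close> at \<open>z = r cis x\<close>.\<close>

lemma sin_power_series:
  assumes r: "0 \<le> r" "r < 1"
  shows "(\<lambda>n. - (r ^ Suc n * sin (real (Suc n) * x) / real (Suc n))) sums Im (Ln (1 - of_real r * cis x))"
proof -
  let ?w = "of_real r * cis x"
  have "cmod (- ?w) < 1" using r by (simp add: norm_mult)
  from Ln_series'[OF this] have "(\<lambda>n. - (?w ^ n) / of_nat n) sums Ln (1 - ?w)" by simp
  then have "(\<lambda>n. - (?w ^ Suc n) / of_nat (Suc n)) sums Ln (1 - ?w)" by (subst sums_Suc_iff) simp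
  then have "(\<lambda>n. Im (- (?w ^ Suc n) / of_nat (Suc n))) sums Im (Ln (1 - ?w))" by (rule sums_Im)
  moreover have "Im (- (?w ^ Suc n) / of_nat (Suc n)) = - (r ^ Suc n * sin (real (Suc n) * x) / real (Suc n))" for n
  proof -
    have "?w ^ Suc n = of_real (r ^ Suc n) * cis (real (Suc n) * x)"
      by (simp only: power_mult_distrib of_real_power Complex.DeMoivre)
    then have "Im (- (?w ^ Suc n)) = Im (- (of_real (r ^ Suc n) * cis (real (Suc n) * x)))" by (simp only:)
    also have "\<dots> = - (r ^ Suc n * sin (real (Suc n) * x))"
      by (simp del: power_Suc of_nat_Suc of_real_power)
    finally have "Im (- (?w ^ Suc n)) = - (r ^ Suc n * sin (real (Suc n) * x))" .
    then show ?thesis by (simp only: Im_divide_of_nat)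
  qed
  ultimately show ?thesis by simp
qed

text \<open>For \<open>r < 1\<close> the factor \<open>r\<^sup>n\<close> dominates the differentiated series uniformly in \<open>x\<close>.\<close>

lemma cos_power_series_derivative:
  assumes r: "0 \<le> r" "r < 1"
  shows "((\<lambda>x. \<Sum>n. r ^ Suc n * cos (real (Suc n) * x) / (real (Suc n))\<^sup>2)
    has_field_derivative Im (Ln (1 - of_real r * cis x))) (at x)"
proof -
  have sr: "summable (\<lambda>n. r ^ Suc n)" using r by (subst summable_Suc_iff) (simp add: summable_geometric)
  have bd: "norm (r ^ Suc n * q / p) \<le> r ^ Suc n" if "\<bar>q\<bar> \<le> 1" "1 \<le> p" for n and q p :: real
  proof -
    have "\<bar>r ^ Suc n * q / p\<bar> = r ^ Suc n * (\<bar>q\<bar> / p)" using r that by (simp add: abs_mult)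
    also have "\<dots> \<le> r ^ Suc n * 1" using r that by (intro mult_left_mono) (auto simp: divide_le_eq)
    finally show ?thesis by simp
  qed
  have "((\<lambda>x. \<Sum>n. r ^ Suc n * cos (real (Suc n) * x) / (real (Suc n))\<^sup>2)
    has_field_derivative (\<Sum>n. - (r ^ Suc n * sin (real (Suc n) * x) / real (Suc n)))) (at x)"
  proof (rule has_field_derivative_series'(2)[where S=UNIV])
    show "uniformly_convergent_on UNIV (\<lambda>n x. \<Sum>i<n. - (r ^ Suc i * sin (real (Suc i) * x) / real (Suc i)))"
      by (rule Weierstrass_m_test'[OF _ sr]) (use bd in \<open>simp del: power_Suc of_nat_Suc\<close>)
    show "summable (\<lambda>n. r ^ Suc n * cos (real (Suc n) * 0) / (real (Suc n))\<^sup>2)"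
      by (rule summable_comparison_test'[OF sr]) (rule bd; simp)
    fix n :: nat and x :: real
    have "((\<lambda>x. cos (real (Suc n) * x)) has_field_derivative (- sin (real (Suc n) * x) * real (Suc n))) (at x)"
      by (auto intro!: derivative_eq_intros simp del: of_nat_Suc)
    then have "((\<lambda>x. (r ^ Suc n / (real (Suc n))\<^sup>2) * cos (real (Suc n) * x)) has_field_derivative
       (r ^ Suc n / (real (Suc n))\<^sup>2) * (- sin (real (Suc n) * x) * real (Suc n))) (at x)"
      by (rule DERIV_cmult)
    moreover have "(r ^ Suc n / (real (Suc n))\<^sup>2) * (- sin (real (Suc n) * x) * real (Suc n))
        = - (r ^ Suc n * sin (real (Suc n) * x) / real (Suc n))"
      by (simp add: power2_eq_square del: power_Suc of_nat_Suc)
    ultimately show "((\<lambda>x. r ^ Suc n * cos (real (Suc n) * x) / (real (Suc n))\<^sup>2) has_field_derivative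
       - (r ^ Suc n * sin (real (Suc n) * x) / real (Suc n))) (at x within UNIV)"
      by (simp add: mult_ac del: power_Suc of_nat_Suc)
  qed auto
  then show ?thesis using sums_unique[OF sin_power_series[OF r, of x]] by simp
qed

lemma cos_power_series_Abel:
  assumes r: "r \<longlonglongrightarrow> 1" "\<And>j. 0 \<le> r j" "\<And>j. r j \<le> (1 :: real)"
  shows "(\<lambda>j. \<Sum>n. r j ^ Suc n * cos (real (Suc n) * x) / (real (Suc n))\<^sup>2)
     \<longlonglongrightarrow> (\<Sum>n. cos (real (Suc n) * x) / (real (Suc n))\<^sup>2)"
proof -
  have "eventually (\<lambda>j. summable (\<lambda>n. norm (r j ^ Suc n * cos (real (Suc n) * x) / (real (Suc n))\<^sup>2))) sequentially \<and>
        summable (\<lambda>n. norm (cos (real (Suc n) * x) / (real (Suc n))\<^sup>2)) \<and>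
        (\<lambda>j. \<Sum>n. r j ^ Suc n * cos (real (Suc n) * x) / (real (Suc n))\<^sup>2)
     \<longlonglongrightarrow> (\<Sum>n. cos (real (Suc n) * x) / (real (Suc n))\<^sup>2)"
  proof (rule tannerys_theorem)
    show "(\<lambda>j. r j ^ Suc n * cos (real (Suc n) * x) / (real (Suc n))\<^sup>2) \<longlonglongrightarrow> cos (real (Suc n) * x) / (real (Suc n))\<^sup>2" for n
    proof -
      have "(\<lambda>j. r j ^ Suc n * cos (real (Suc n) * x) / (real (Suc n))\<^sup>2) \<longlonglongrightarrow> 1 ^ Suc n * cos (real (Suc n) * x) / (real (Suc n))\<^sup>2"
        by (intro tendsto_intros r) simp
      then show ?thesis by (simp only: power_one mult_1)
    qed
    have "norm (r j ^ Suc n * cos (real (Suc n) * x) / (real (Suc n))\<^sup>2) \<le> 1 / (real (Suc n))\<^sup>2" for n j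
    proof -
      have "\<bar>r j ^ Suc n * cos (real (Suc n) * x)\<bar> \<le> 1"
        unfolding abs_mult using r(2)[of j] r(3)[of j]
        by (intro mult_le_one) (auto simp: power_le_one abs_of_nonneg simp del: power_Suc)
      then show ?thesis by (simp add: divide_right_mono del: power_Suc of_nat_Suc)
    qed
    then show "eventually (\<lambda>(n, j). norm (r j ^ Suc n * cos (real (Suc n) * x) / (real (Suc n))\<^sup>2) \<le> 1 / (real (Suc n))\<^sup>2) (at_top \<times>\<^sub>F sequentially)"
      by (intro always_eventually) (auto simp del: power_Suc of_nat_Suc)
    show "summable (\<lambda>n. 1 / (real (Suc n))\<^sup>2)" by (rule summable_inverse_Suc_squares)
  qed simp
  then show ?thesis by blast
qed

text \<open>The termwise derivative \<open>- \<Sum> sin(k x) / k\<close> converges only conditionally, so the series is first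
  damped by \<open>r\<^sup>k\<close>. The damped derivative is \<open>Im (Ln (1 - r cis x))\<close>, is bounded by \<open>\<pi>\<close>, and tends to
  \<open>(x - \<pi>)/2\<close> as \<open>r \<rightarrow> 1\<close>. Dominated convergence for the integral over \<open>[0, x]\<close> determines the
  undamped series up to its value at \<open>0\<close>, which is Euler's \<open>\<pi>\<^sup>2/6\<close>.\<close>

lemma cos_series_Bernoulli:
  assumes x: "0 \<le> x" "x \<le> 2 * pi"
  shows "(\<lambda>n. cos (real (Suc n) * x) / (real (Suc n))\<^sup>2) sums (x\<^sup>2 / 4 - pi * x / 2 + pi\<^sup>2 / 6)"
proof -
  define G where "G r x = (\<Sum>n. r ^ Suc n * cos (real (Suc n) * x) / (real (Suc n))\<^sup>2)" for r x :: real
  define S where "S x = (\<Sum>n. cos (real (Suc n) * x) / (real (Suc n))\<^sup>2)" for x :: real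
  have S0: "S 0 = pi\<^sup>2 / 6"
    using inverse_squares_sums by (simp add: S_def sums_iff add.commute)
  have Sum: "(\<lambda>n. cos (real (Suc n) * x) / (real (Suc n))\<^sup>2) sums S x" for x
    unfolding S_def
    by (intro summable_sums summable_comparison_test'[OF summable_inverse_Suc_squares])
      (simp add: divide_right_mono del: of_nat_Suc)
  define r where "r j = 1 - 1 / real (Suc j)" for j
  have r: "r \<longlonglongrightarrow> 1" "\<And>j. 0 \<le> r j" "\<And>j. r j < 1"
  proof -
    have "(\<lambda>j. 1 - 1 / real (Suc j)) \<longlonglongrightarrow> 1 - 0"
      by (intro tendsto_diff tendsto_const) (use LIMSEQ_inverse_real_of_nat in \<open>simp add: inverse_eq_divide\<close>)
    then show "r \<longlonglongrightarrow> 1" by (simp add: r_def[abs_def])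
  qed (auto simp: r_def)
  have main: "S x = x\<^sup>2 / 4 - pi * x / 2 + pi\<^sup>2 / 6" if x: "0 \<le> x" "x < 2 * pi" for x
  proof -
    define D where "D j y = Im (Ln (1 - of_real (r j) * cis y))" for j y
    have Dint: "(D j has_integral (G (r j) x - G (r j) 0)) {0..x}" for j
    proof (rule fundamental_theorem_of_calculus[OF x(1)])
      fix y
      have "(G (r j) has_field_derivative D j y) (at y)"
        unfolding G_def[abs_def] D_def by (rule cos_power_series_derivative[OF r(2,3)])
      then show "(G (r j) has_vector_derivative D j y) (at y within {0..x})"
        by (simp add: has_real_derivative_iff_has_vector_derivative has_vector_derivative_at_within)
    qed
    \<comment> \<open>At \<open>0\<close> the damped derivatives vanish while \<open>(y - \<pi>)/2\<close> does not; a single point does not affect the integral.\<close>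
    define g where "g y = (if y = 0 then 0 else (y - pi) / 2)" for y
    have lim: "(\<lambda>j. D j y) \<longlonglongrightarrow> g y" if y: "y \<in> {0..x}" for y
    proof (cases "y = 0")
      case True
      have "1 - complex_of_real (r j) = of_real (1 / real (Suc j))" for j by (simp add: r_def)
      moreover have "Im (Ln (complex_of_real (1 / real (Suc j)))) = 0" for j
        by (subst Ln_of_real) auto
      ultimately have "D j y = 0" for j
        using True by (simp only: D_def cis_zero mult_1_right)
      then show ?thesis using True by (simp add: g_def)
    next
      case False
      then have y': "0 < y" "y < 2 * pi" using y x by auto
      have "(\<lambda>j. 1 - of_real (r j) * cis y) \<longlonglongrightarrow> 1 - of_real 1 * cis y"
        by (intro tendsto_intros r)
      then have "(\<lambda>j. 1 - of_real (r j) * cis y) \<longlonglongrightarrow> 1 - cis y" by simp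
      then have "(\<lambda>j. D j y) \<longlonglongrightarrow> Im (Ln (1 - cis y))"
        unfolding D_def by (intro tendsto_Im tendsto_Ln Im_Ln_one_minus_cis(2) y')
      then show ?thesis using False by (simp add: g_def Im_Ln_one_minus_cis(1)[OF y'])
    qed
    have bound: "norm (D j y) \<le> pi" if "y \<in> {0..x}" for j y
    proof -
      have "1 - of_real (r j) * cis y \<noteq> 0"
      proof
        assume "1 - of_real (r j) * cis y = 0"
        then have "cmod (of_real (r j) * cis y) = 1" by (metis eq_iff_diff_eq_0 norm_one)
        then show False using r(2,3)[of j] by (simp add: norm_mult)
      qed
      from mpi_less_Im_Ln[OF this] Im_Ln_le_pi[OF this] show ?thesis
        unfolding D_def real_norm_def by linarith
    qed
    have gint: "(g has_integral (x\<^sup>2 / 4 - pi * x / 2)) {0..x}"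
    proof (rule has_integral_spike_finite[of "{0}"])
      have "((\<lambda>y. (y - pi) / 2) has_integral ((x\<^sup>2 / 4 - pi * x / 2) - (0\<^sup>2 / 4 - pi * 0 / 2))) {0..x}"
      proof (rule fundamental_theorem_of_calculus[OF x(1)])
        fix y
        have "((\<lambda>y. y\<^sup>2 / 4 - pi * y / 2) has_real_derivative (y - pi) / 2) (at y within {0..x})"
          by (auto intro!: derivative_eq_intros simp: diff_divide_distrib)
        then show "((\<lambda>y. y\<^sup>2 / 4 - pi * y / 2) has_vector_derivative (y - pi) / 2) (at y within {0..x})"
          by (simp add: has_real_derivative_iff_has_vector_derivative)
      qed
      then show "((\<lambda>y. (y - pi) / 2) has_integral (x\<^sup>2 / 4 - pi * x / 2)) {0..x}" by simp
    qed (auto simp: g_def)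
    have "(\<lambda>j. integral {0..x} (D j)) \<longlonglongrightarrow> integral {0..x} g"
      by (rule dominated_convergence(2)[where h="\<lambda>_. pi"])
        (use Dint lim bound in \<open>auto simp: has_integral_integrable\<close>)
    then have "(\<lambda>j. G (r j) x - G (r j) 0) \<longlonglongrightarrow> x\<^sup>2 / 4 - pi * x / 2"
      by (simp only: integral_unique[OF Dint] integral_unique[OF gint])
    moreover have "(\<lambda>j. G (r j) x - G (r j) 0) \<longlonglongrightarrow> S x - S 0"
      unfolding G_def S_def using r
      by (intro tendsto_diff cos_power_series_Abel) (auto intro: less_imp_le)
    ultimately have "S x - S 0 = x\<^sup>2 / 4 - pi * x / 2" by (rule LIMSEQ_unique[rotated])
    then show ?thesis using S0 by simp
  qed
  show ?thesis
  \<comment> \<open>At the right end the limit of the derivatives is again exceptional; periodicity gives the value there.\<close>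
  proof (cases "x = 2 * pi")
    case True
    have "cos (real k * (2 * pi)) = cos (real k * 0)" for k
      using cos_2npi[of k] by (simp add: mult_ac)
    then have "S x = S 0" unfolding S_def True by (simp only:)
    moreover have "x\<^sup>2 / 4 - pi * x / 2 + pi\<^sup>2 / 6 = pi\<^sup>2 / 6" by (simp add: True power2_eq_square)
    ultimately show ?thesis using Sum[of x] S0 by (simp only:)
  next
    case False
    then show ?thesis using main[of x] Sum[of x] x by simp
  qed
qed

text \<open>The product-to-sum formula turns \<open>2 cos(k\<pi>s) cos(k\<pi>t)\<close> into \<open>cos(k a) + cos(k b)\<close> with
  \<open>a = \<pi> \<bar>s - t\<bar>\<close> and \<open>b = \<pi> (s + t)\<close>, both in \<open>[0, 2\<pi>]\<close>.\<close>

lemma centered_wiener_kernel_Mercer: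
  assumes s: "s \<in> {0..1}" and t: "t \<in> {0..1}"
  shows "(\<lambda>n. 1 / (real (Suc n) * pi)\<^sup>2 * (sqrt 2 * cos (real (Suc n) * pi * s)) * (sqrt 2 * cos (real (Suc n) * pi * t)))
    sums centered_wiener_kernel s t"
proof -
  define a where "a = \<bar>s - t\<bar> * pi"
  define b where "b = (s + t) * pi"
  have "0 \<le> a" "a \<le> 2 * pi" "0 \<le> b" "b \<le> 2 * pi"
    using s t unfolding a_def b_def by (auto intro!: mult_right_mono)
  then have "(\<lambda>n. (cos (real (Suc n) * a) / (real (Suc n))\<^sup>2 + cos (real (Suc n) * b) / (real (Suc n))\<^sup>2) / pi\<^sup>2)
     sums (((a\<^sup>2 / 4 - pi * a / 2 + pi\<^sup>2 / 6) + (b\<^sup>2 / 4 - pi * b / 2 + pi\<^sup>2 / 6)) / pi\<^sup>2)"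
    by (intro sums_divide sums_add cos_series_Bernoulli)
  moreover have "((a\<^sup>2 / 4 - pi * a / 2 + pi\<^sup>2 / 6) + (b\<^sup>2 / 4 - pi * b / 2 + pi\<^sup>2 / 6)) / pi\<^sup>2 = centered_wiener_kernel s t"
    unfolding a_def b_def centered_wiener_kernel_def
    by (cases "s \<le> t") (simp_all add: field_simps power2_eq_square)
  moreover have "(cos (real (Suc n) * a) / (real (Suc n))\<^sup>2 + cos (real (Suc n) * b) / (real (Suc n))\<^sup>2) / pi\<^sup>2
     = 1 / (real (Suc n) * pi)\<^sup>2 * (sqrt 2 * cos (real (Suc n) * pi * s)) * (sqrt 2 * cos (real (Suc n) * pi * t))" for n
  proof -
    have "cos (real (Suc n) * a) = cos (real (Suc n) * pi * s - real (Suc n) * pi * t)"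
    proof (cases "s \<le> t")
      case True
      then have "real (Suc n) * a = - (real (Suc n) * pi * s - real (Suc n) * pi * t)" by (simp add: a_def algebra_simps)
      then show ?thesis by (simp only: cos_minus)
    next
      case False
      then have "real (Suc n) * a = real (Suc n) * pi * s - real (Suc n) * pi * t" by (simp add: a_def algebra_simps)
      then show ?thesis by (simp only:)
    qed
    moreover have "real (Suc n) * b = real (Suc n) * pi * s + real (Suc n) * pi * t" by (simp add: b_def algebra_simps)
    moreover have "1 / p * (sqrt 2 * u) * (sqrt 2 * v) = 2 * (u * v) / p" for p u v :: real
      by (simp add: algebra_simps)
    moreover have "(u / p + v / p) / q = 2 * ((u + v) / 2) / (p * q)" for u v p q :: real
      by (simp add: add_divide_distrib)
    ultimately show ?thesis
      by (simp only: cos_times_cos power_mult_distrib)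
  qed
  ultimately show ?thesis by (simp only:)
qed

section \<open>Eigenfunctions of kernels given by an expansion\<close>

lemma unit_lebesgue_finite: "finite_measure unit_lebesgue"
  by (rule finite_measure_lebesgue_on) simp

lemma continuous_unit_lebesgue_integral:
  fixes f :: "real \<Rightarrow> real"
  assumes "continuous_on {0..1} f" "(f has_integral I) {0..1}"
  shows "(LINT t|unit_lebesgue. f t) = I"
  using lebesgue_integral_eq_integral[OF continuous_imp_integrable_real[OF assms(1)]] assms(2)
  by (simp add: integral_unique)

lemma continuous_square_integrable_unit_lebesgue:
  assumes "continuous_on {0..1} f"
  shows "square_integrable unit_lebesgue f"
  unfolding square_integrable_def
proof
  show "f \<in> borel_measurable unit_lebesgue"
    using assms by (intro continuous_imp_measurable_on_sets_lebesgue) auto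
  show "integrable unit_lebesgue (\<lambda>x. (f x)\<^sup>2)"
    using assms by (intro continuous_imp_integrable_real continuous_intros)
qed

lemma (in finite_measure) square_integrable_const: "square_integrable M (\<lambda>_. c)"
  by (simp add: square_integrable_def)

lemma dominated_sums_integral:
  fixes f :: "nat \<Rightarrow> 'a \<Rightarrow> real"
  assumes f: "\<And>n. integrable M (f n)" and H: "integrable M H" and g: "summable g"
    and bd: "\<And>n x. x \<in> space M \<Longrightarrow> \<bar>f n x\<bar> \<le> g n * H x"
    and F: "F \<in> borel_measurable M" "AE x in M. (\<lambda>n. f n x) sums F x"
  shows "(\<lambda>n. \<integral>x. f n x \<partial>M) sums (\<integral>x. F x \<partial>M)"
proof -
  have [measurable]: "f n \<in> borel_measurable M" for n using f by auto
  have "(\<lambda>n. \<integral>x. f n x \<partial>M) sums (\<integral>x. (\<Sum>n. f n x) \<partial>M)"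
  proof (rule sums_integral[OF f])
    show "AE x in M. summable (\<lambda>n. norm (f n x))"
      by (intro AE_I2 summable_comparison_test'[OF summable_mult2[OF g], of 0]) (use bd in auto)
    show "summable (\<lambda>n. \<integral>x. norm (f n x) \<partial>M)"
    proof (rule summable_comparison_test'[OF summable_mult2[OF g, of "\<integral>x. H x \<partial>M"], of 0])
      fix n
      have "(\<integral>x. norm (f n x) \<partial>M) \<le> (\<integral>x. g n * H x \<partial>M)"
        using f H bd by (intro integral_mono) auto
      then show "norm (\<integral>x. norm (f n x) \<partial>M) \<le> g n * (\<integral>x. H x \<partial>M)" by simp
    qed
  qed
  also have "(\<integral>x. (\<Sum>n. f n x) \<partial>M) = (\<integral>x. F x \<partial>M)"
  proof (rule integral_cong_AE)
    show "AE x in M. (\<Sum>n. f n x) = F x" using F(2) by eventually_elim (simp add: sums_iff)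
  qed (use F(1) in measurable)
  finally show ?thesis .
qed

text \<open>Termwise integration is justified by the bound \<open>\<lambda>\<^sub>n B\<^sup>2 \<bar>h\<bar>\<close>: a square integrable \<open>h\<close> is integrable on
  the unit interval.\<close>

lemma fredholm_Mercer_sums:
  assumes e: "orthonormal_seq e" and bd: "\<And>k t. 1 \<le> k \<Longrightarrow> t \<in> {0..1} \<Longrightarrow> \<bar>e k t\<bar> \<le> B"
    and lam: "\<And>k. 1 \<le> k \<Longrightarrow> 0 \<le> lam k" "summable (\<lambda>n. lam (Suc n))"
    and K: "\<And>s t. s \<in> {0..1} \<Longrightarrow> t \<in> {0..1} \<Longrightarrow> (\<lambda>n. lam (Suc n) * e (Suc n) s * e (Suc n) t) sums K s t"
    and h: "square_integrable unit_lebesgue h" and t: "t \<in> {0..1}"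
  shows "(\<lambda>n. lam (Suc n) * (LINT s|unit_lebesgue. e (Suc n) s * h s) * e (Suc n) t) sums fredholm K h t"
proof -
  interpret finite_measure unit_lebesgue by (rule unit_lebesgue_finite)
  have e2: "square_integrable unit_lebesgue (e (Suc n))" for n using e by (simp add: orthonormal_seq_def)
  have B: "0 \<le> B" using bd[of 1 0] abs_ge_zero[of "e 1 0"] by simp
  have ih: "integrable unit_lebesgue h"
    using square_integrable_mult[OF h square_integrable_const[of 1]] by simp
  define f where "f n s = lam (Suc n) * e (Suc n) t * (e (Suc n) s * h s)" for n s
  have fi: "integrable unit_lebesgue (f n)" for n
    unfolding f_def using square_integrable_mult[OF e2 h] by simp
  have fb: "\<bar>f n s\<bar> \<le> lam (Suc n) * (B * B * \<bar>h s\<bar>)" if s: "s \<in> {0..1}" for n s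
  proof -
    have "\<bar>f n s\<bar> = lam (Suc n) * (\<bar>e (Suc n) t\<bar> * \<bar>e (Suc n) s\<bar> * \<bar>h s\<bar>)"
      using lam(1)[of "Suc n"] by (simp add: f_def abs_mult)
    also have "\<dots> \<le> lam (Suc n) * (B * B * \<bar>h s\<bar>)"
      using bd[of "Suc n"] s t B lam(1)[of "Suc n"] by (intro mult_left_mono mult_right_mono mult_mono) auto
    finally show ?thesis .
  qed
  have fs: "(\<lambda>n. f n s) sums (K s t * h s)" if s: "s \<in> {0..1}" for s
    using sums_mult2[OF K[OF s t], of "h s"] by (simp add: f_def mult_ac)
  have "(\<lambda>n. LINT s|unit_lebesgue. f n s) sums (LINT s|unit_lebesgue. K s t * h s)"
  proof (rule dominated_sums_integral[OF fi _ lam(2), where H="\<lambda>s. B * B * \<bar>h s\<bar>"])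
    show "(\<lambda>s. K s t * h s) \<in> borel_measurable unit_lebesgue"
    proof (rule borel_measurable_LIMSEQ_real)
      show "(\<lambda>m. \<Sum>n<m. f n s) \<longlonglongrightarrow> K s t * h s" if "s \<in> space unit_lebesgue" for s
        using fs[of s] that by (simp add: sums_def)
      show "(\<lambda>s. \<Sum>n<m. f n s) \<in> borel_measurable unit_lebesgue" for m
        using fi by (intro borel_measurable_sum borel_measurable_integrable)
    qed
  qed (use fb fs ih in auto)
  moreover have "(LINT s|unit_lebesgue. f n s) = lam (Suc n) * (LINT s|unit_lebesgue. e (Suc n) s * h s) * e (Suc n) t" for n
    unfolding f_def integral_mult_right_zero by (simp only: mult_ac)
  ultimately show ?thesis by (simp only: fredholm_def)
qed

text \<open>Let \<open>a\<^sub>k = \<langle>h, e\<^sub>k\<rangle>\<close>, so that \<open>T h = \<Sum> \<lambda>\<^sub>k a\<^sub>k e\<^sub>k\<close>. For \<open>h = e\<^sub>j\<close> only one term survives, which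
  gives \<open>T e\<^sub>j = \<lambda>\<^sub>j e\<^sub>j\<close>. Conversely, if \<open>T h = \<mu> h\<close>, pairing with \<open>e\<^sub>j\<close> gives \<open>\<mu> a\<^sub>j = \<lambda>\<^sub>j a\<^sub>j\<close>. Hence
  \<open>a\<^sub>j = 0\<close> unless \<open>\<lambda>\<^sub>j = \<mu>\<close>, and for \<open>\<mu> \<noteq> 0\<close> the expansion of \<open>T h = \<mu> h\<close> reduces to the sum over the
  indices with eigenvalue \<open>\<mu>\<close>. That sum is finite because \<open>\<lambda>\<^sub>k \<rightarrow> 0\<close>.\<close>

lemma eigen_system_Mercer:
  assumes e: "orthonormal_seq e" and bd: "\<And>k t. 1 \<le> k \<Longrightarrow> t \<in> {0..1} \<Longrightarrow> \<bar>e k t\<bar> \<le> B"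
    and lam: "\<And>k. 1 \<le> k \<Longrightarrow> 0 \<le> lam k" "summable (\<lambda>n. lam (Suc n))"
    and dec: "\<And>j k. 1 \<le> j \<Longrightarrow> j \<le> k \<Longrightarrow> lam k \<le> lam j"
    and K: "\<And>s t. s \<in> {0..1} \<Longrightarrow> t \<in> {0..1} \<Longrightarrow> (\<lambda>n. lam (Suc n) * e (Suc n) s * e (Suc n) t) sums K s t"
  shows "eigen_system K lam e"
proof -
  interpret finite_measure unit_lebesgue by (rule unit_lebesgue_finite)
  have T: "(\<lambda>n. lam (Suc n) * (LINT s|unit_lebesgue. e (Suc n) s * h s) * e (Suc n) t) sums fredholm K h t"
    if "square_integrable unit_lebesgue h" "t \<in> {0..1}" for h t
    by (rule fredholm_Mercer_sums[OF e _ _ lam(2) _ that]) (use bd lam(1) K in auto)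
  have e2: "square_integrable unit_lebesgue (e k)" if "1 \<le> k" for k using e that by (simp add: orthonormal_seq_def)
  have orth: "(LINT s|unit_lebesgue. e j s * e k s) = (if j = k then 1 else 0)" if "1 \<le> j" "1 \<le> k" for j k
    using e that by (simp add: orthonormal_seq_def)
  have eigen: "fredholm K (e j) t = lam j * e j t" if j: "1 \<le> j" and t: "t \<in> {0..1}" for j t
  proof -
    obtain i where i: "j = Suc i" using j by (cases j) auto
    have "(\<lambda>n. lam (Suc n) * (LINT s|unit_lebesgue. e (Suc n) s * e j s) * e (Suc n) t) sums fredholm K (e j) t"
      by (rule T) (use e2 j t in auto)
    moreover have "lam (Suc n) * (LINT s|unit_lebesgue. e (Suc n) s * e j s) * e (Suc n) t
        = (if n = i then lam j * e j t else 0)" for n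
      using orth[of "Suc n" j] j i by simp
    ultimately have "(\<lambda>n. if n = i then lam j * e j t else 0) sums fredholm K (e j) t" by simp
    then show ?thesis using sums_If_finite_set[of "{i}" "\<lambda>_. lam j * e j t"] by (auto dest: sums_unique2)
  qed
  have fin: "finite {k. 1 \<le> k \<and> lam k = \<mu>}" if "\<mu> \<noteq> 0" for \<mu>
  proof -
    have "(\<lambda>n. lam (Suc n)) \<longlonglongrightarrow> 0" using lam(2) by (rule summable_LIMSEQ_zero)
    then have "eventually (\<lambda>n. lam (Suc n) \<noteq> \<mu>) sequentially"
      using that by (intro tendsto_imp_eventually_ne) auto
    then obtain m where m: "\<And>n. n \<ge> m \<Longrightarrow> lam (Suc n) \<noteq> \<mu>" by (auto simp: eventually_sequentially)
    have "k \<le> m" if k: "1 \<le> k" "lam k = \<mu>" for k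
    proof (rule ccontr)
      assume "\<not> k \<le> m"
      then have "m \<le> k - 1" "Suc (k - 1) = k" by auto
      with m[of "k - 1"] k(2) show False by metis
    qed
    then have "{k. 1 \<le> k \<and> lam k = \<mu>} \<subseteq> {..m}" by auto
    then show ?thesis by (rule finite_subset) simp
  qed
  have span: "\<exists>c. AE t in unit_lebesgue. h t = (\<Sum>k | 1 \<le> k \<and> lam k = \<mu>. c k * e k t)"
    if \<mu>: "\<mu> \<noteq> 0" and h: "in_eigenspace K \<mu> h" for \<mu> h
  proof -
    have h2: "square_integrable unit_lebesgue h" and hT: "AE t in unit_lebesgue. fredholm K h t = \<mu> * h t"
      using h by (auto simp: in_eigenspace_def)
    define a where "a k = (LINT s|unit_lebesgue. e k s * h s)" for k
    have Th: "(\<lambda>n. lam (Suc n) * a (Suc n) * e (Suc n) t) sums fredholm K h t" if "t \<in> {0..1}" for t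
      unfolding a_def by (rule T[OF h2 that])
    have adj: "\<mu> * a j = lam j * a j" if j: "1 \<le> j" for j
    proof -
      obtain i where i: "j = Suc i" using j by (cases j) auto
      define A where "A = B * (LINT s|unit_lebesgue. \<bar>h s\<bar>)"
      have B: "0 \<le> B" using bd[of 1 0] abs_ge_zero[of "e 1 0"] by simp
      have ih: "integrable unit_lebesgue h"
        using square_integrable_mult[OF h2 square_integrable_const[of 1]] by simp
      have aA: "\<bar>a k\<bar> \<le> A" if k: "1 \<le> k" for k
      proof -
        have "\<bar>a k\<bar> \<le> (LINT s|unit_lebesgue. \<bar>e k s * h s\<bar>)"
          unfolding a_def by (rule integral_abs_bound)
        also have "\<dots> \<le> (LINT s|unit_lebesgue. B * \<bar>h s\<bar>)"
        proof (rule integral_mono)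
          show "integrable unit_lebesgue (\<lambda>s. \<bar>e k s * h s\<bar>)"
            by (intro integrable_abs square_integrable_mult e2 k h2)
          show "integrable unit_lebesgue (\<lambda>s. B * \<bar>h s\<bar>)" using ih by simp
          show "\<bar>e k s * h s\<bar> \<le> B * \<bar>h s\<bar>" if "s \<in> space unit_lebesgue" for s
            using bd[OF k, of s] that by (simp add: abs_mult mult_right_mono)
        qed
        finally show ?thesis by (simp add: A_def)
      qed
      have "(\<lambda>n. LINT t|unit_lebesgue. lam (Suc n) * a (Suc n) * (e (Suc n) t * e j t)) sums (LINT t|unit_lebesgue. \<mu> * (e j t * h t))"
      proof (rule dominated_sums_integral[OF _ _ lam(2), where H="\<lambda>_. A * (B * B)"])
        show "integrable unit_lebesgue (\<lambda>t. lam (Suc n) * a (Suc n) * (e (Suc n) t * e j t))" for n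
          using square_integrable_mult[OF e2[of "Suc n"] e2[OF j]] by simp
        show "(\<lambda>t. \<mu> * (e j t * h t)) \<in> borel_measurable unit_lebesgue"
          using square_integrable_mult[OF e2[OF j] h2] by auto
        show "AE t in unit_lebesgue. (\<lambda>n. lam (Suc n) * a (Suc n) * (e (Suc n) t * e j t)) sums (\<mu> * (e j t * h t))"
          using hT AE_space
        proof eventually_elim
          fix t assume ht: "fredholm K h t = \<mu> * h t" and "t \<in> space unit_lebesgue"
          then show "(\<lambda>n. lam (Suc n) * a (Suc n) * (e (Suc n) t * e j t)) sums (\<mu> * (e j t * h t))"
            using sums_mult2[OF Th[of t], of "e j t"] by (simp add: mult_ac)
        qed
        show "\<bar>lam (Suc n) * a (Suc n) * (e (Suc n) t * e j t)\<bar> \<le> lam (Suc n) * (A * (B * B))"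
          if "t \<in> space unit_lebesgue" for n t
        proof -
          have "lam (Suc n) * (\<bar>a (Suc n)\<bar> * (\<bar>e (Suc n) t\<bar> * \<bar>e j t\<bar>)) \<le> lam (Suc n) * (A * (B * B))"
            using that j B bd aA[of "Suc n"] lam(1)[of "Suc n"] abs_ge_zero[of "a (Suc n)"]
            by (intro mult_left_mono mult_mono) (auto intro: order_trans)
          then show ?thesis using lam(1)[of "Suc n"] by (simp add: abs_mult mult.assoc)
        qed
      qed simp
      moreover have "(LINT t|unit_lebesgue. lam (Suc n) * a (Suc n) * (e (Suc n) t * e j t)) = (if n = i then lam j * a j else 0)" for n
        using orth[of "Suc n" j] j i by simp
      moreover have "(LINT t|unit_lebesgue. \<mu> * (e j t * h t)) = \<mu> * a j" by (simp add: a_def)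
      ultimately have "(\<lambda>n. if n = i then lam j * a j else 0) sums (\<mu> * a j)" by (simp only:)
      then show ?thesis using sums_If_finite_set[of "{i}" "\<lambda>_. lam j * a j"] by (auto dest: sums_unique2)
    qed
    have zero: "a k = 0" if "1 \<le> k" "lam k \<noteq> \<mu>" for k using adj[of k] that by auto
    show ?thesis
    proof (intro exI[of _ "\<lambda>k. a k"])
      show "AE t in unit_lebesgue. h t = (\<Sum>k | 1 \<le> k \<and> lam k = \<mu>. a k * e k t)"
        using hT AE_space
      proof eventually_elim
        fix t assume ht: "fredholm K h t = \<mu> * h t" and "t \<in> space unit_lebesgue"
        then have t: "t \<in> {0..1}" by simp
        let ?A = "{n. lam (Suc n) = \<mu>}"
        have bij: "bij_betw Suc ?A {k. 1 \<le> k \<and> lam k = \<mu>}"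
          by (rule bij_betwI[where g="\<lambda>k. k - 1"]) auto
        then have "finite ?A" using fin[OF \<mu>] bij_betw_finite by blast
        then have "(\<lambda>n. lam (Suc n) * a (Suc n) * e (Suc n) t) sums (\<Sum>n\<in>?A. lam (Suc n) * a (Suc n) * e (Suc n) t)"
          by (rule sums_finite) (use zero in auto)
        with Th[OF t] have "\<mu> * h t = (\<Sum>n\<in>?A. lam (Suc n) * a (Suc n) * e (Suc n) t)"
          using ht by (auto dest: sums_unique2)
        also have "\<dots> = (\<Sum>n\<in>?A. \<mu> * (a (Suc n) * e (Suc n) t))" by (intro sum.cong) auto
        also have "\<dots> = (\<Sum>k | 1 \<le> k \<and> lam k = \<mu>. \<mu> * (a k * e k t))"
          by (rule sum.reindex_bij_betw[OF bij])
        finally show "h t = (\<Sum>k | 1 \<le> k \<and> lam k = \<mu>. a k * e k t)"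
          using \<mu> by (simp add: sum_distrib_left[symmetric])
      qed
    qed
  qed
  show ?thesis
    unfolding eigen_system_def
    using e lam(1) dec eigen e2 fin span by (auto simp: in_eigenspace_def intro!: AE_I2)
qed

lemma orthonormal_cosines: "orthonormal_seq (\<lambda>k t. sqrt 2 * cos (real k * pi * t))"
  unfolding orthonormal_seq_def
proof (intro conjI allI impI)
  show "square_integrable unit_lebesgue (\<lambda>t. sqrt 2 * cos (real k * pi * t))" for k
    by (intro continuous_square_integrable_unit_lebesgue continuous_intros)
  fix j k :: nat assume jk: "1 \<le> j" "1 \<le> k"
  have I: "((\<lambda>t. cos (of_int m * pi * t)) has_integral (if m = 0 then 1 else 0)) {0..1}" for m :: int
  proof (cases "m = 0")
    case True
    then show ?thesis using has_integral_const_real[of "1::real" 0 1] by simp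
  next
    case False
    define q where "q = of_int m * pi"
    have q: "q \<noteq> 0" using False by (simp add: q_def)
    have "((\<lambda>t. cos (q * t)) has_integral (sin (q * 1) / q - sin (q * 0) / q)) {0..1}"
    proof (rule fundamental_theorem_of_calculus)
      fix t
      have "((\<lambda>t. sin (q * t) / q) has_real_derivative cos (q * t)) (at t within {0..1})"
        using q by (auto intro!: derivative_eq_intros)
      then show "((\<lambda>t. sin (q * t) / q) has_vector_derivative cos (q * t)) (at t within {0..1})"
        by (simp add: has_real_derivative_iff_has_vector_derivative)
    qed simp
    moreover have "sin q = 0" using sin_npi_int[of m] by (simp add: q_def mult.commute)
    ultimately show ?thesis using False by (simp add: q_def)
  qed
  have eq: "sqrt 2 * cos (real j * pi * t) * (sqrt 2 * cos (real k * pi * t))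
      = cos (of_int (int j - int k) * pi * t) + cos (of_int (int j + int k) * pi * t)" for t
  proof -
    have two: "sqrt 2 * u * (sqrt 2 * v) = 2 * (u * v)" for u v :: real by (simp add: algebra_simps)
    show ?thesis unfolding two cos_times_cos by (simp add: algebra_simps)
  qed
  have "((\<lambda>t. sqrt 2 * cos (real j * pi * t) * (sqrt 2 * cos (real k * pi * t))) has_integral
      ((if int j - int k = 0 then 1 else 0) + (if int j + int k = 0 then 1 else 0))) {0..1}"
    unfolding eq by (intro has_integral_add I)
  then show "(LINT t|unit_lebesgue. sqrt 2 * cos (real j * pi * t) * (sqrt 2 * cos (real k * pi * t))) = (if j = k then 1 else 0)"
    using jk by (intro continuous_unit_lebesgue_integral continuous_intros) auto
qed

section \<open>Gaussian series and the Karhunen-Loeve expansion\<close>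

lemma iid_std_normal_combination:
  assumes \<omega>: "iid_std_normal N \<omega>" and A: "A \<subseteq> {1..}"
  shows "gaussian_char N (\<lambda>y. \<Sum>k\<in>A. b k * \<omega> k y) (\<Sum>k\<in>A. (b k)\<^sup>2)"
proof -
  interpret prob_space N using \<omega> by (simp add: iid_std_normal_def)
  have ind: "indep_vars (\<lambda>_. borel) \<omega> A"
    using \<omega> A by (auto simp: iid_std_normal_def intro: indep_vars_subset)
  have "gaussian_char N (\<omega> k) 1" if "k \<in> A" for k
  proof -
    have "distributed N lborel (\<omega> k) (normal_density 0 1)" using \<omega> A that by (auto simp: iid_std_normal_def)
    from gaussian_char_normal[OF prob_space_axioms _ this] show ?thesis by simp
  qed
  from gaussian_char_sum[OF prob_space_axioms ind this, of b] show ?thesis by simp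
qed

text \<open>The squared \<open>L\<^sup>2\<close> distance of two partial sums is a section of the convergent series \<open>\<Sum> b\<^sub>k\<^sup>2\<close>.\<close>

lemma iid_std_normal_series_L2:
  assumes \<omega>: "iid_std_normal N \<omega>" and b: "summable (\<lambda>n. (b (Suc n))\<^sup>2)"
  shows "\<exists>Y. square_integrable N Y \<and> (\<lambda>n. LINT y|N. ((\<Sum>k=1..n. b k * \<omega> k y) - Y y)\<^sup>2) \<longlonglongrightarrow> 0"
proof -
  interpret prob_space N using \<omega> by (simp add: iid_std_normal_def)
  define X where "X n y = (\<Sum>k=1..n. b k * \<omega> k y)" for n y
  note g = iid_std_normal_combination[OF \<omega>, of "{_.._}"]
  have X: "square_integrable N (X n)" for n
    unfolding X_def by (rule gaussian_char_second_moment(1)[OF prob_space_axioms g]) auto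
  have dist: "(\<integral>y. (X m y - X n y)\<^sup>2 \<partial>N) = (\<Sum>i\<in>{n..<m}. (b (Suc i))\<^sup>2)" if "n \<le> m" for m n
  proof -
    have "X m y - X n y = (\<Sum>k=Suc n..m. b k * \<omega> k y)" for y
    proof -
      have "{1..m} = {1..n} \<union> {Suc n..m}" using that by auto
      then have "X m y = X n y + (\<Sum>k=Suc n..m. b k * \<omega> k y)"
        unfolding X_def by (simp add: sum.union_disjoint)
      then show ?thesis by simp
    qed
    moreover have "(\<integral>y. (\<Sum>k=Suc n..m. b k * \<omega> k y)\<^sup>2 \<partial>N) = (\<Sum>k=Suc n..m. (b k)\<^sup>2)"
      by (rule gaussian_char_second_moment(2)[OF prob_space_axioms g]) auto
    moreover have "(\<Sum>k=Suc n..m. (b k)\<^sup>2) = (\<Sum>i\<in>{n..<m}. (b (Suc i))\<^sup>2)"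
      by (rule sum.reindex_bij_witness[of _ Suc "\<lambda>k. k - 1"]) auto
    ultimately show ?thesis by simp
  qed
  have "\<exists>K. \<forall>m\<ge>K. \<forall>n\<ge>K. (\<integral>y. (X m y - X n y)\<^sup>2 \<partial>N) \<le> e" if "e > 0" for e
  proof -
    have "\<exists>K. \<forall>m\<ge>K. \<forall>n. norm (\<Sum>i\<in>{m..<n}. (b (Suc i))\<^sup>2) < e"
      using b that unfolding summable_Cauchy by blast
    then obtain K where K: "\<And>m n. m \<ge> K \<Longrightarrow> norm (\<Sum>i\<in>{m..<n}. (b (Suc i))\<^sup>2) < e" by blast
    have le: "(\<integral>y. (X m y - X n y)\<^sup>2 \<partial>N) \<le> e" if "n \<ge> K" "n \<le> m" for m n
      using K[of n m] dist[of n m] that by (simp add: abs_le_iff)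
    have "(\<integral>y. (X m y - X n y)\<^sup>2 \<partial>N) \<le> e" if "m \<ge> K" "n \<ge> K" for m n
      using le[of n m] le[of m n] that by (cases "n \<le> m") (simp_all add: power2_commute)
    then show ?thesis by blast
  qed
  then obtain Y where "square_integrable N Y" "(\<lambda>n. \<integral>y. (X n y - Y y)\<^sup>2 \<partial>N) \<longlonglongrightarrow> 0"
    using Riesz_Fischer[where X=X, OF X] by blast
  then show ?thesis unfolding X_def by blast
qed

text \<open>The general principle behind the expansion: any factorization \<open>K(s,t) = \<Sum> b\<^sub>k(s) b\<^sub>k(t)\<close> of the covariance
  of a centered Gaussian process represents its law as that of \<open>\<Sum> \<omega>\<^sub>k b\<^sub>k\<close>. Finite linear
  combinations of the mean square limits \<open>Y\<^sub>t\<close> are Gaussian, with variance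
  \<open>\<Sum>\<^sub>k (\<Sum>\<^sub>t c\<^sub>t b\<^sub>k(t))\<^sup>2 = \<Sum>\<^sub>s\<^sub>,\<^sub>t c\<^sub>s c\<^sub>t K(s,t)\<close>, so they have the same characteristic functions as those
  of the given process.\<close>

lemma gaussian_law_eq_series:
  fixes \<zeta> :: "real \<Rightarrow> 'a \<Rightarrow> real" and b :: "nat \<Rightarrow> real \<Rightarrow> real"
  assumes M: "prob_space M" and \<zeta>: "\<And>t. t \<in> I \<Longrightarrow> \<zeta> t \<in> borel_measurable M"
    and gauss: "\<And>J c. finite J \<Longrightarrow> J \<subseteq> I \<Longrightarrow>
      gaussian_char M (\<lambda>x. \<Sum>t\<in>J. c t * \<zeta> t x) (\<Sum>s\<in>J. \<Sum>t\<in>J. c s * c t * K s t)"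
    and \<omega>: "iid_std_normal N \<omega>"
    and K: "\<And>s t. s \<in> I \<Longrightarrow> t \<in> I \<Longrightarrow> (\<lambda>n. b (Suc n) s * b (Suc n) t) sums K s t"
  shows "law_eq_series M I \<zeta> N (\<lambda>k t y. \<omega> k y * b k t)"
proof -
  interpret N: prob_space N using \<omega> by (simp add: iid_std_normal_def)
  define S where "S n t y = (\<Sum>k=1..n. b k t * \<omega> k y)" for n t y
  note g = iid_std_normal_combination[OF \<omega>]
  have sq: "square_integrable N (\<lambda>y. \<omega> k y * b k t)" if "1 \<le> k" for k t
    using gaussian_char_second_moment(1)[OF N.prob_space_axioms g[of "{k}" "\<lambda>k. b k t"]] that
    by (simp add: mult.commute)
  have Ssq: "square_integrable N (S n t)" for n t
    unfolding S_def by (rule gaussian_char_second_moment(1)[OF N.prob_space_axioms g]) auto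
  have "\<exists>Y. square_integrable N Y \<and> (\<lambda>n. LINT y|N. (S n t y - Y y)\<^sup>2) \<longlonglongrightarrow> 0" if "t \<in> I" for t
    unfolding S_def using K[OF that that]
    by (intro iid_std_normal_series_L2 \<omega>) (auto simp: power2_eq_square sums_iff)
  then have "\<forall>t\<in>I. \<exists>Y. square_integrable N Y \<and> (\<lambda>n. LINT y|N. (S n t y - Y y)\<^sup>2) \<longlonglongrightarrow> 0" by blast
  from bchoice[OF this] obtain Y where Ysq: "\<And>t. t \<in> I \<Longrightarrow> square_integrable N (Y t)"
    and Ylim: "\<And>t. t \<in> I \<Longrightarrow> (\<lambda>n. LINT y|N. (S n t y - Y t y)\<^sup>2) \<longlonglongrightarrow> 0" by auto
  have Ym: "Y t \<in> borel_measurable N" if "t \<in> I" for t using Ysq[OF that] by (simp add: square_integrable_def)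
  have Yg: "gaussian_char N (\<lambda>y. \<Sum>t\<in>J. c t * Y t y) (\<Sum>s\<in>J. \<Sum>t\<in>J. c s * c t * K s t)"
    if J: "finite J" "J \<subseteq> I" for J c
  proof -
    have D: "square_integrable N (\<lambda>y. S n t y - Y t y)" if "t \<in> J" for n t
      using that J by (intro square_integrable_diff Ssq Ysq) auto
    have diff: "(\<Sum>t\<in>J. c t * S n t y) - (\<Sum>t\<in>J. c t * Y t y) = (\<Sum>t\<in>J. c t * (S n t y - Y t y))" for n y
      by (simp add: right_diff_distrib sum_subtractf)
    have Dsq: "square_integrable N (\<lambda>y. (\<Sum>t\<in>J. c t * S n t y) - (\<Sum>t\<in>J. c t * Y t y))" for n
      unfolding diff by (intro square_integrable_sum square_integrable_cmult D)
    show ?thesis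
    proof (rule gaussian_char_L2_limit[OF N.prob_space_axioms])
      show "gaussian_char N (\<lambda>y. \<Sum>t\<in>J. c t * S n t y) (\<Sum>k=1..n. (\<Sum>t\<in>J. c t * b k t)\<^sup>2)" for n
      proof -
        have "(\<Sum>t\<in>J. c t * S n t y) = (\<Sum>k=1..n. (\<Sum>t\<in>J. c t * b k t) * \<omega> k y)" for y
          unfolding S_def sum_distrib_left sum_distrib_right by (subst sum.swap) (simp add: mult.assoc)
        then show ?thesis using g[of "{1..n}" "\<lambda>k. \<Sum>t\<in>J. c t * b k t"] by simp
      qed
      show "(\<lambda>y. \<Sum>t\<in>J. c t * Y t y) \<in> borel_measurable N"
        using J Ym by (intro borel_measurable_sum borel_measurable_times borel_measurable_const) auto
      show "integrable N (\<lambda>y. ((\<Sum>t\<in>J. c t * S n t y) - (\<Sum>t\<in>J. c t * Y t y))\<^sup>2)" for n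
        using Dsq[of n] by (simp add: square_integrable_def)
      show "(\<lambda>n. LINT y|N. ((\<Sum>t\<in>J. c t * S n t y) - (\<Sum>t\<in>J. c t * Y t y))\<^sup>2) \<longlonglongrightarrow> 0"
      proof (rule tendsto_sandwich[OF _ _ tendsto_const])
        have Di: "integrable N (\<lambda>y. (S n t y - Y t y)\<^sup>2)" if "t \<in> J" for n t
          using D[OF that] by (simp add: square_integrable_def)
        have le: "(LINT y|N. ((\<Sum>t\<in>J. c t * S n t y) - (\<Sum>t\<in>J. c t * Y t y))\<^sup>2)
           \<le> (LINT y|N. (\<Sum>t\<in>J. (c t)\<^sup>2 * (S n t y - Y t y)\<^sup>2) * card J)" for n
        proof (rule integral_mono)
          show "integrable N (\<lambda>y. ((\<Sum>t\<in>J. c t * S n t y) - (\<Sum>t\<in>J. c t * Y t y))\<^sup>2)"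
            using Dsq[of n] by (simp add: square_integrable_def)
          show "integrable N (\<lambda>y. (\<Sum>t\<in>J. (c t)\<^sup>2 * (S n t y - Y t y)\<^sup>2) * card J)"
            using Di by (intro integrable_mult_left Bochner_Integration.integrable_sum integrable_mult_right) auto
          \<comment> \<open>Cauchy-Schwarz for a sum of \<open>card J\<close> terms.\<close>
          show "((\<Sum>t\<in>J. c t * S n t y) - (\<Sum>t\<in>J. c t * Y t y))\<^sup>2 \<le> (\<Sum>t\<in>J. (c t)\<^sup>2 * (S n t y - Y t y)\<^sup>2) * card J" for y
            unfolding diff using sum_squared_le_sum_of_squares[of "\<lambda>t. c t * (S n t y - Y t y)" J]
            by (simp add: power_mult_distrib)
        qed
        have eq: "(LINT y|N. (\<Sum>t\<in>J. (c t)\<^sup>2 * (S n t y - Y t y)\<^sup>2) * card J)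
            = (\<Sum>t\<in>J. (c t)\<^sup>2 * (LINT y|N. (S n t y - Y t y)\<^sup>2)) * card J" for n
          using Di by (simp add: Bochner_Integration.integral_sum)
        show "eventually (\<lambda>n. (LINT y|N. ((\<Sum>t\<in>J. c t * S n t y) - (\<Sum>t\<in>J. c t * Y t y))\<^sup>2)
           \<le> (\<Sum>t\<in>J. (c t)\<^sup>2 * (LINT y|N. (S n t y - Y t y)\<^sup>2)) * card J) sequentially"
          using le unfolding eq by (intro always_eventually allI)
        have "(\<lambda>n. (\<Sum>t\<in>J. (c t)\<^sup>2 * (LINT y|N. (S n t y - Y t y)\<^sup>2)) * card J) \<longlonglongrightarrow> (\<Sum>t\<in>J. (c t)\<^sup>2 * 0) * card J"
          using J by (intro tendsto_intros Ylim) auto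
        then show "(\<lambda>n. (\<Sum>t\<in>J. (c t)\<^sup>2 * (LINT y|N. (S n t y - Y t y)\<^sup>2)) * card J) \<longlonglongrightarrow> 0" by simp
      qed simp
      have "(\<lambda>n. \<Sum>s\<in>J. \<Sum>t\<in>J. c s * c t * (b (Suc n) s * b (Suc n) t)) sums (\<Sum>s\<in>J. \<Sum>t\<in>J. c s * c t * K s t)"
        using J by (intro sums_sum sums_mult K) auto
      moreover have "(\<Sum>s\<in>J. \<Sum>t\<in>J. c s * c t * (b k s * b k t)) = (\<Sum>t\<in>J. c t * b k t)\<^sup>2" for k
        by (simp add: power2_eq_square sum_product mult_ac)
      ultimately have "(\<lambda>n. (\<Sum>t\<in>J. c t * b (Suc n) t)\<^sup>2) sums (\<Sum>s\<in>J. \<Sum>t\<in>J. c s * c t * K s t)" by simp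
      then have "(\<lambda>n. \<Sum>i<n. (\<Sum>t\<in>J. c t * b (Suc i) t)\<^sup>2) \<longlonglongrightarrow> (\<Sum>s\<in>J. \<Sum>t\<in>J. c s * c t * K s t)"
        by (simp add: sums_def)
      moreover have "(\<Sum>i<n. (\<Sum>t\<in>J. c t * b (Suc i) t)\<^sup>2) = (\<Sum>k=1..n. (\<Sum>t\<in>J. c t * b k t)\<^sup>2)" for n
        by (rule sum.reindex_bij_witness[of _ "\<lambda>k. k - 1" Suc]) auto
      ultimately show "(\<lambda>n. \<Sum>k=1..n. (\<Sum>t\<in>J. c t * b k t)\<^sup>2) \<longlonglongrightarrow> (\<Sum>s\<in>J. \<Sum>t\<in>J. c s * c t * K s t)" by simp
    qed
  qed
  have law: "process_law M I \<zeta> = process_law N I Y"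
  proof (rule process_law_eqI[OF M N.prob_space_axioms \<zeta> Ym])
    fix L c a assume L: "finite L" "L \<subseteq> I"
    show "(\<integral>x. cos ((\<Sum>t\<in>L. c t * \<zeta> t x) + a) \<partial>M) = (\<integral>y. cos ((\<Sum>t\<in>L. c t * Y t y) + a) \<partial>N)"
      by (simp only: gaussian_char_expectation_cos[OF M gauss[OF L]]
          gaussian_char_expectation_cos[OF N.prob_space_axioms Yg[OF L]])
  qed
  show ?thesis
    unfolding law_eq_series_def
  proof (intro conjI allI impI ballI exI[of _ Y] law sq Ysq)
    show "(\<lambda>n. LINT y|N. ((\<Sum>k=1..n. \<omega> k y * b k t) - Y t y)\<^sup>2) \<longlonglongrightarrow> 0" if "t \<in> I" for t
      using Ylim[OF that] by (simp add: S_def mult.commute)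
  qed
qed

lemma law_eq_series_cong:
  assumes "\<And>k t y. 1 \<le> k \<Longrightarrow> t \<in> I \<Longrightarrow> X k t y = X' k t y"
  shows "law_eq_series M I \<zeta> N X \<longleftrightarrow> law_eq_series M I \<zeta> N X'"
proof -
  have 1: "X k t = X' k t" if "1 \<le> k" "t \<in> I" for k t
    by (intro ext assms that)
  have 2: "(\<Sum>k=1..n. X k t y) = (\<Sum>k=1..n. X' k t y)" if "t \<in> I" for n t y
    using that by (intro sum.cong refl assms) auto
  have "(\<forall>k\<ge>1. \<forall>t\<in>I. square_integrable N (X k t)) \<longleftrightarrow> (\<forall>k\<ge>1. \<forall>t\<in>I. square_integrable N (X' k t))"
    using 1 by auto
  moreover have "(\<forall>t\<in>I. square_integrable N (Y t) \<and> (\<lambda>n. LINT y|N. ((\<Sum>k=1..n. X k t y) - Y t y)\<^sup>2) \<longlonglongrightarrow> 0)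
      \<longleftrightarrow> (\<forall>t\<in>I. square_integrable N (Y t) \<and> (\<lambda>n. LINT y|N. ((\<Sum>k=1..n. X' k t y) - Y t y)\<^sup>2) \<longlonglongrightarrow> 0)" for Y
    by (intro ball_cong refl) (simp only: 2)
  ultimately show ?thesis unfolding law_eq_series_def by (simp only:)
qed

text \<open>By polarization, from the variances of \<open>\<zeta> s\<close>, \<open>\<zeta> t\<close> and \<open>\<zeta> s + \<zeta> t\<close>.\<close>

lemma covariance_gaussian:
  assumes M: "prob_space M"
    and gauss: "\<And>J c. finite J \<Longrightarrow> J \<subseteq> I \<Longrightarrow>
      gaussian_char M (\<lambda>x. \<Sum>t\<in>J. c t * \<zeta> t x) (\<Sum>s\<in>J. \<Sum>t\<in>J. c s * c t * K s t)"
    and sym: "K s t = K t s" and st: "s \<in> I" "t \<in> I"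
  shows "covariance M \<zeta> s t = K s t"
proof -
  have one: "gaussian_char M (\<zeta> r) (K r r)" if "r \<in> I" for r
    using gauss[of "{r}" "\<lambda>_. 1"] that by simp
  note sq = gaussian_char_second_moment(1)[OF M one]
  note mom = gaussian_char_second_moment(2)[OF M one]
  show ?thesis
  proof (cases "s = t")
    case True
    then show ?thesis using mom[OF st(1)] by (simp add: covariance_def power2_eq_square)
  next
    case False
    have "gaussian_char M (\<lambda>x. \<zeta> s x + \<zeta> t x) (K s s + 2 * K s t + K t t)"
      using gauss[of "{s, t}" "\<lambda>_. 1"] st False sym by (simp add: algebra_simps)
    from gaussian_char_second_moment(2)[OF M this]
    have "K s s + 2 * K s t + K t t = (\<integral>x. (\<zeta> s x)\<^sup>2 + (\<zeta> t x)\<^sup>2 + 2 * (\<zeta> s x * \<zeta> t x) \<partial>M)"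
      by (simp add: power2_sum mult.assoc)
    also have "\<dots> = K s s + K t t + 2 * covariance M \<zeta> s t"
      using sq[OF st(1)] sq[OF st(2)] square_integrable_mult[OF sq[OF st(1)] sq[OF st(2)]] mom[OF st(1)] mom[OF st(2)]
      by (simp add: square_integrable_def covariance_def)
    finally show ?thesis by simp
  qed
qed

theorem theorem1p1:
  fixes M :: "'a measure" and W :: "real \<Rightarrow> 'a \<Rightarrow> real"
    and N :: "'b measure" and \<omega> :: "nat \<Rightarrow> 'b \<Rightarrow> real"
  assumes "standard_wiener M W"
    and "iid_std_normal N \<omega>"
  shows "KL_expansion (completion M) (mean_centered W)
           (\<lambda>k. 1 / (real k * pi)\<^sup>2) (\<lambda>k t. sqrt 2 * cos (real k * pi * t)) N \<omega> \<and>
         law_eq_series (completion M) {0..1} (\<lambda>t x. W t x - (LINT u:{0..1}|lborel. W u x))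
           N (\<lambda>k t y. \<omega> k y * (sqrt 2 * cos (real k * pi * t) / (real k * pi)))"
proof -
  note W = assms(1) and \<omega> = assms(2)
  interpret prob_space M using W by (simp add: standard_wiener_def)
  note CM = prob_space_completion
  let ?M = "completion M" and ?Z = "mean_centered W"
  let ?lam = "\<lambda>k. 1 / (real k * pi)\<^sup>2" and ?e = "\<lambda>k t. sqrt 2 * cos (real k * pi * t)"
  let ?b = "\<lambda>k t. sqrt 2 * cos (real k * pi * t) / (real k * pi)"
  note gauss = mean_centered_gaussian[OF W]
  have cov: "covariance ?M ?Z s t = centered_wiener_kernel s t" if "s \<in> {0..1}" "t \<in> {0..1}" for s t
    by (rule covariance_gaussian[OF CM gauss _ that]) (simp_all add: centered_wiener_kernel_def max.commute add.commute)
  have process: "centered_gaussian_process ?M {0..1} ?Z"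
    unfolding centered_gaussian_process_def
    using CM gaussian_char_imp_centered_gaussian[OF CM gauss] by blast
  have sq_cov: "square_integrable (lebesgue_on ({0..1} \<times> {0..1})) (\<lambda>(s, t). covariance ?M ?Z s t)"
  proof -
    have box: "{0..1} \<times> {0..1} = cbox (0::real, 0::real) (1, 1)" by (simp add: cbox_Pair_eq)
    have cont: "continuous_on ({0..1} \<times> {0..1}) (\<lambda>(s, t). centered_wiener_kernel s t)"
      unfolding centered_wiener_kernel_def case_prod_unfold by (intro continuous_intros) auto
    have "square_integrable (lebesgue_on ({0..1} \<times> {0..1})) (\<lambda>(s, t). centered_wiener_kernel s t)"
      unfolding square_integrable_def
    proof
      show "(\<lambda>(s, t). centered_wiener_kernel s t) \<in> borel_measurable (lebesgue_on ({0..1} \<times> {0..1}))"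
        by (rule continuous_imp_measurable_on_sets_lebesgue[OF cont]) (simp add: box)
      show "integrable (lebesgue_on ({0..1} \<times> {0..1})) (\<lambda>x. (case x of (s, t) \<Rightarrow> centered_wiener_kernel s t)\<^sup>2)"
        unfolding box
        by (rule continuous_imp_integrable) (use cont in \<open>intro continuous_intros; simp add: box\<close>)
    qed
    moreover have "square_integrable (lebesgue_on ({0..1} \<times> {0..1})) (\<lambda>(s, t). covariance ?M ?Z s t)
        \<longleftrightarrow> square_integrable (lebesgue_on ({0..1} \<times> {0..1})) (\<lambda>(s, t). centered_wiener_kernel s t)"
      by (rule square_integrable_cong) (auto simp: cov space_restrict_space)
    ultimately show ?thesis by blast
  qed
  have system: "eigen_system (covariance ?M ?Z) ?lam ?e"
  proof (rule eigen_system_Mercer[OF orthonormal_cosines])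
    show "\<bar>?e k t\<bar> \<le> sqrt 2" for k t
      by (simp add: abs_mult mult_left_le)
    have "summable (\<lambda>n. 1 / pi\<^sup>2 * (1 / (real (Suc n))\<^sup>2))"
      by (intro summable_mult summable_inverse_Suc_squares)
    then show "summable (\<lambda>n. ?lam (Suc n))" by (simp add: power_mult_distrib mult.commute del: of_nat_Suc)
    show "?lam k \<le> ?lam j" if "1 \<le> j" "j \<le> k" for j k
      using that by (intro divide_left_mono power_mono mult_right_mono) auto
    show "(\<lambda>n. ?lam (Suc n) * ?e (Suc n) s * ?e (Suc n) t) sums covariance ?M ?Z s t"
      if "s \<in> {0..1}" "t \<in> {0..1}" for s t
      unfolding cov[OF that] by (rule centered_wiener_kernel_Mercer[OF that])
  qed simp
  have series: "law_eq_series ?M {0..1} ?Z N (\<lambda>k t y. \<omega> k y * ?b k t)"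
  proof (rule gaussian_law_eq_series[OF CM _ gauss \<omega>])
    show "?Z t \<in> borel_measurable ?M" if "t \<in> {0..1}" for t
      using that by (intro mean_centered_measurable[OF W]) simp
    show "(\<lambda>n. ?b (Suc n) s * ?b (Suc n) t) sums centered_wiener_kernel s t"
      if "s \<in> {0..1}" "t \<in> {0..1}" for s t
    proof -
      have "?b k s * ?b k t = ?lam k * ?e k s * ?e k t" for k by (simp add: power2_eq_square)
      then show ?thesis using centered_wiener_kernel_Mercer[OF that] by (simp only:)
    qed
  qed
  have root: "law_eq_series ?M {0..1} ?Z N (\<lambda>k t y. \<omega> k y * sqrt (?lam k) * ?e k t)"
    by (rule iffD1[OF law_eq_series_cong series]) (simp add: real_sqrt_divide)
  have "?Z = (\<lambda>t x. W t x - (LINT u:{0..1}|lborel. W u x))" by (simp add: fun_eq_iff mean_centered_def)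
  with series have series': "law_eq_series ?M {0..1} (\<lambda>t x. W t x - (LINT u:{0..1}|lborel. W u x))
           N (\<lambda>k t y. \<omega> k y * ?b k t)" by simp
  show ?thesis
    unfolding KL_expansion_def using process sq_cov system \<omega> root series' by blast
qed

end
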